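(* Let $n\ge2$, let $P_n$ be the polycyclic monoid on $n$ generators, given by its standard presentation on the generating set $\Sigma_0=A_n\cup A_n^{-1}\cup\{0\}$, and let $i\in\{p,c\}$. Then, given two words $x,y\in\Sigma_0^*$, it can be tested in time $O(m)$, where $m=\max\{|x|,|y|\}$, whether or not $x\sim_i y$ holds in $P_n$ (that is, whether the elements of $P_n$ represented by $x$ and $y$ are related by $\sim_i$).
   Context: For elements $a,b$ of a monoid $M$, $a\sim_p b$ means that there exist $u,v\in M$ with $a=uv$ and $b=vu$. For a monoid $M$ with zero and $a\in M\setminus\{0\}$, let $\mathbb P(a)=\{g\in M:(\forall m\in M)\ mag=0\Rightarrow ma=0\}$, and let $\mathbb P(0)=\{0\}$; if $M$ has no zero, $\mathbb P(a)=M$ for all $a\in M$. Define $a\sim_c b$ to mean: there exist $g\in\mathbb P(a)$ and $h\in\mathbb P(b)$ with $ag=gb$ and $bh=ha$. Polycyclic monoid: let $n\ge2$, $A_n=\{p_1,\dots,p_n\}$, $A_n^{-1}=\{p_1^{-1},\dots,p_n^{-1}\}$ a disjoint copy, $\Sigma=A_n\cup A_n^{-1}$, $\Sigma_0=\Sigma\cup\{0\}$. $P_n$ is the monoid generated by $\Sigma_0$ with defining relations $p_i^{-1}p_i=1$, $p_i^{-1}p_j=0$ for $i\ne j$, and $x0=0$, $0x=0$, $00=0$ for $x\in\Sigma$. The element $0$ is the zero of $P_n$. $|w|$ denotes the length of a word $w$. The number $n$ (and $i$) is fixed, and time is the number of steps of a standard sequential model of computation such as a multitape Turing machine. *)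

theory Defs
  imports "HOL-Algebra.Group" "HOL-Library.Landau_Symbols"
begin

section \<open>Conjugacy relations in a monoid\<close>

definition is_zero :: "('a, 'b) monoid_scheme \<Rightarrow> 'a \<Rightarrow> bool" where
  "is_zero M z \<longleftrightarrow> z \<in> carrier M \<and> (\<forall>x\<in>carrier M. x \<otimes>\<^bsub>M\<^esub> z = z \<and> z \<otimes>\<^bsub>M\<^esub> x = z)"

definition p_conjugate :: "('a, 'b) monoid_scheme \<Rightarrow> 'a \<Rightarrow> 'a \<Rightarrow> bool" where
  "p_conjugate M a b \<longleftrightarrow>
     (\<exists>u\<in>carrier M. \<exists>v\<in>carrier M. a = u \<otimes>\<^bsub>M\<^esub> v \<and> b = v \<otimes>\<^bsub>M\<^esub> u)"

text \<open>The set \<open>P(a)\<close>; a zero of a monoid is unique, so \<open>{a}\<close> is \<open>{0}\<close> below.\<close>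

definition conjugators :: "('a, 'b) monoid_scheme \<Rightarrow> 'a \<Rightarrow> 'a set" where
  "conjugators M a =
     (if \<nexists>z. is_zero M z then carrier M
      else if is_zero M a then {a}
      else {g \<in> carrier M. \<forall>m\<in>carrier M.
              is_zero M (m \<otimes>\<^bsub>M\<^esub> a \<otimes>\<^bsub>M\<^esub> g) \<longrightarrow> is_zero M (m \<otimes>\<^bsub>M\<^esub> a)})"

definition c_conjugate :: "('a, 'b) monoid_scheme \<Rightarrow> 'a \<Rightarrow> 'a \<Rightarrow> bool" where
  "c_conjugate M a b \<longleftrightarrow>
     (\<exists>g\<in>conjugators M a. \<exists>h\<in>conjugators M b.
        a \<otimes>\<^bsub>M\<^esub> g = g \<otimes>\<^bsub>M\<^esub> b \<and> b \<otimes>\<^bsub>M\<^esub> h = h \<otimes>\<^bsub>M\<^esub> a)"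


section \<open>Monoids given by presentations\<close>

inductive_set pres_cong :: "'a set \<Rightarrow> ('a list \<times> 'a list) set \<Rightarrow> ('a list \<times> 'a list) set"
  for S :: "'a set" and R :: "('a list \<times> 'a list) set" where
  rel: "(l, r) \<in> R \<Longrightarrow> l \<in> lists S \<Longrightarrow> r \<in> lists S \<Longrightarrow> u \<in> lists S \<Longrightarrow> v \<in> lists S
          \<Longrightarrow> (u @ l @ v, u @ r @ v) \<in> pres_cong S R"
| refl: "w \<in> lists S \<Longrightarrow> (w, w) \<in> pres_cong S R"
| sym: "(u, v) \<in> pres_cong S R \<Longrightarrow> (v, u) \<in> pres_cong S R"
| trans: "(u, v) \<in> pres_cong S R \<Longrightarrow> (v, w) \<in> pres_cong S R \<Longrightarrow> (u, w) \<in> pres_cong S R"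

definition word_class :: "'a set \<Rightarrow> ('a list \<times> 'a list) set \<Rightarrow> 'a list \<Rightarrow> 'a list set" where
  "word_class S R w = pres_cong S R `` {w}"

definition presented_monoid :: "'a set \<Rightarrow> ('a list \<times> 'a list) set \<Rightarrow> 'a list set monoid" where
  "presented_monoid S R =
     \<lparr>carrier = lists S // pres_cong S R,
      mult = (\<lambda>A B. \<Union>a\<in>A. \<Union>b\<in>B. word_class S R (a @ b)),
      one = word_class S R []\<rparr>"

lemma pres_cong_in_lists:
  "(u, v) \<in> pres_cong S R \<Longrightarrow> u \<in> lists S \<and> v \<in> lists S"
  by (induction rule: pres_cong.induct) auto

lemma equiv_pres_cong: "equiv (lists S) (pres_cong S R)"
proof (rule equivI)
  show "pres_cong S R \<subseteq> lists S \<times> lists S"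
    by (clarify, drule pres_cong_in_lists) simp
  show "refl_on (lists S) (pres_cong S R)"
    by (intro refl_onI pres_cong.refl)
  show "sym (pres_cong S R)"
    by (rule symI) (rule pres_cong.sym)
  show "trans (pres_cong S R)"
    by (rule transI) (rule pres_cong.trans)
qed

lemma pres_cong_append_right:
  "(u, v) \<in> pres_cong S R \<Longrightarrow> w \<in> lists S \<Longrightarrow> (u @ w, v @ w) \<in> pres_cong S R"
proof (induction rule: pres_cong.induct)
  case (rel l r u v)
  then show ?case using pres_cong.rel[of l r R S u "v @ w"] by simp
next
  case (refl u)
  then show ?case by (simp add: pres_cong.refl)
next
  case (sym u v)
  then show ?case by (simp add: pres_cong.sym)
next
  case (trans u v w')
  then show ?case by (metis pres_cong.trans)
qed

lemma pres_cong_append_left: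
  "(u, v) \<in> pres_cong S R \<Longrightarrow> w \<in> lists S \<Longrightarrow> (w @ u, w @ v) \<in> pres_cong S R"
proof (induction rule: pres_cong.induct)
  case (rel l r u v)
  then show ?case using pres_cong.rel[of l r R S "w @ u" v] by simp
next
  case (refl u)
  then show ?case by (simp add: pres_cong.refl)
next
  case (sym u v)
  then show ?case by (simp add: pres_cong.sym)
next
  case (trans u v w')
  then show ?case by (metis pres_cong.trans)
qed

lemma pres_cong_append:
  assumes "(u, u') \<in> pres_cong S R" "(v, v') \<in> pres_cong S R"
  shows "(u @ v, u' @ v') \<in> pres_cong S R"
  using assms pres_cong.trans[OF pres_cong_append_right pres_cong_append_left]
    pres_cong_in_lists by metis

lemma word_class_eq_iff:
  "u \<in> lists S \<Longrightarrow> v \<in> lists S \<Longrightarrow> word_class S R u = word_class S R v \<longleftrightarrow> (u, v) \<in> pres_cong S R"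
  unfolding word_class_def by (rule eq_equiv_class_iff[OF equiv_pres_cong])

lemma word_class_in_carrier:
  "w \<in> lists S \<Longrightarrow> word_class S R w \<in> carrier (presented_monoid S R)"
  by (simp add: presented_monoid_def word_class_def quotientI)

lemma presented_monoid_carrierE:
  assumes "A \<in> carrier (presented_monoid S R)"
  obtains w where "w \<in> lists S" "A = word_class S R w"
  using assms that unfolding presented_monoid_def word_class_def
  by (metis monoid.select_convs(1) partial_object.select_convs(1) quotientE)

lemma mult_word_class:
  assumes "u \<in> lists S" "v \<in> lists S"
  shows "word_class S R u \<otimes>\<^bsub>presented_monoid S R\<^esub> word_class S R v = word_class S R (u @ v)"
proof -
  have "word_class S R (a @ b) = word_class S R (u @ v)"
    if "a \<in> word_class S R u" "b \<in> word_class S R v" for a b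
  proof -
    have "(u, a) \<in> pres_cong S R" "(v, b) \<in> pres_cong S R"
      using that by (auto simp: word_class_def)
    then have "(u @ v, a @ b) \<in> pres_cong S R"
      by (rule pres_cong_append)
    then show ?thesis
      by (metis pres_cong_in_lists word_class_eq_iff)
  qed
  moreover have "u \<in> word_class S R u" "v \<in> word_class S R v"
    using assms by (auto simp: word_class_def intro: pres_cong.refl)
  ultimately have "(\<Union>a\<in>word_class S R u. \<Union>b\<in>word_class S R v. word_class S R (a @ b)) =
      word_class S R (u @ v)"
    by blast
  then show ?thesis
    by (simp add: presented_monoid_def)
qed

lemma monoid_presented_monoid: "monoid (presented_monoid S R)"
proof (rule monoidI)
  have one: "\<one>\<^bsub>presented_monoid S R\<^esub> = word_class S R []"
    by (simp add: presented_monoid_def)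
  show "\<one>\<^bsub>presented_monoid S R\<^esub> \<in> carrier (presented_monoid S R)"
    by (simp add: one word_class_in_carrier)
  fix x assume x: "x \<in> carrier (presented_monoid S R)"
  then show "\<one>\<^bsub>presented_monoid S R\<^esub> \<otimes>\<^bsub>presented_monoid S R\<^esub> x = x"
    and "x \<otimes>\<^bsub>presented_monoid S R\<^esub> \<one>\<^bsub>presented_monoid S R\<^esub> = x"
    by (elim presented_monoid_carrierE, simp add: one mult_word_class)+
  fix y assume y: "y \<in> carrier (presented_monoid S R)"
  show "x \<otimes>\<^bsub>presented_monoid S R\<^esub> y \<in> carrier (presented_monoid S R)"
    using x y by (elim presented_monoid_carrierE) (simp add: mult_word_class word_class_in_carrier)
  fix z assume z: "z \<in> carrier (presented_monoid S R)"
  show "x \<otimes>\<^bsub>presented_monoid S R\<^esub> y \<otimes>\<^bsub>presented_monoid S R\<^esub> z =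
        x \<otimes>\<^bsub>presented_monoid S R\<^esub> (y \<otimes>\<^bsub>presented_monoid S R\<^esub> z)"
    using x y z by (elim presented_monoid_carrierE) (simp add: mult_word_class)
qed


section \<open>The polycyclic monoid\<close>

datatype letter = Gen nat | Inv nat | Zero

definition polycyclic_letters :: "nat \<Rightarrow> letter set" where
  "polycyclic_letters n = Gen ` {1..n} \<union> Inv ` {1..n} \<union> {Zero}"

definition polycyclic_rels :: "nat \<Rightarrow> (letter list \<times> letter list) set" where
  "polycyclic_rels n =
     {([Inv i, Gen i], []) | i. i \<in> {1..n}}
   \<union> {([Inv i, Gen j], [Zero]) | i j. i \<in> {1..n} \<and> j \<in> {1..n} \<and> i \<noteq> j}
   \<union> {([x, Zero], [Zero]) | x. x \<in> Gen ` {1..n} \<union> Inv ` {1..n}}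
   \<union> {([Zero, x], [Zero]) | x. x \<in> Gen ` {1..n} \<union> Inv ` {1..n}}
   \<union> {([Zero, Zero], [Zero])}"

definition polycyclic_monoid :: "nat \<Rightarrow> letter list set monoid" where
  "polycyclic_monoid n = presented_monoid (polycyclic_letters n) (polycyclic_rels n)"

definition polycyclic_elem :: "nat \<Rightarrow> letter list \<Rightarrow> letter list set" where
  "polycyclic_elem n w = word_class (polycyclic_letters n) (polycyclic_rels n) w"

lemma pres_cong_Zero:
  assumes "w \<in> lists (polycyclic_letters n)"
  shows "(w @ [Zero], [Zero]) \<in> pres_cong (polycyclic_letters n) (polycyclic_rels n)"
    and "(Zero # w, [Zero]) \<in> pres_cong (polycyclic_letters n) (polycyclic_rels n)"
proof -
  let ?S = "polycyclic_letters n" and ?R = "polycyclic_rels n"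
  have Z: "[Zero] \<in> lists ?S" by (simp add: polycyclic_letters_def)
  have r: "([x, Zero], [Zero]) \<in> pres_cong ?S ?R" "([Zero, x], [Zero]) \<in> pres_cong ?S ?R"
    if "x \<in> ?S" for x
  proof -
    have "([x, Zero], [Zero]) \<in> ?R" "([Zero, x], [Zero]) \<in> ?R"
      using that by (auto simp: polycyclic_letters_def polycyclic_rels_def)
    then show "([x, Zero], [Zero]) \<in> pres_cong ?S ?R" "([Zero, x], [Zero]) \<in> pres_cong ?S ?R"
      using pres_cong.rel[of "[x, Zero]" "[Zero]" ?R ?S "[]" "[]"]
        pres_cong.rel[of "[Zero, x]" "[Zero]" ?R ?S "[]" "[]"] that Z by auto
  qed
  show "(w @ [Zero], [Zero]) \<in> pres_cong ?S ?R"
    using assms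
  proof (induction w)
    case Nil
    then show ?case using Z by (simp add: pres_cong.refl)
  next
    case (Cons x w)
    then have "([x] @ (w @ [Zero]), [x] @ [Zero]) \<in> pres_cong ?S ?R"
      by (intro pres_cong_append_left) auto
    moreover have "([x] @ [Zero], [Zero]) \<in> pres_cong ?S ?R" using r(1)[of x] Cons by simp
    ultimately have "([x] @ w @ [Zero], [Zero]) \<in> pres_cong ?S ?R"
      by (rule pres_cong.trans)
    then show ?case by simp
  qed
  show "(Zero # w, [Zero]) \<in> pres_cong ?S ?R"
    using assms
  proof (induction w)
    case Nil
    then show ?case using Z by (simp add: pres_cong.refl)
  next
    case (Cons x w)
    then have "([Zero, x] @ w, [Zero] @ w) \<in> pres_cong ?S ?R"
      by (intro pres_cong_append_right r) auto
    moreover have "([Zero] @ w, [Zero]) \<in> pres_cong ?S ?R" using Cons by simp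
    ultimately have "([Zero, x] @ w, [Zero]) \<in> pres_cong ?S ?R"
      by (rule pres_cong.trans)
    then show ?case by simp
  qed
qed

lemma is_zero_polycyclic: "is_zero (polycyclic_monoid n) (polycyclic_elem n [Zero])"
proof -
  have Z: "[Zero] \<in> lists (polycyclic_letters n)" by (simp add: polycyclic_letters_def)
  show ?thesis
    unfolding is_zero_def polycyclic_monoid_def polycyclic_elem_def
  proof (intro conjI ballI, goal_cases)
    case 1
    show ?case by (rule word_class_in_carrier[OF Z])
  next
    case (2 x)
    then show ?case
      using Z by (elim presented_monoid_carrierE)
        (auto simp: mult_word_class word_class_eq_iff pres_cong_Zero)
  next
    case (3 x)
    then show ?case
      using Z by (elim presented_monoid_carrierE)
        (auto simp: mult_word_class word_class_eq_iff pres_cong_Zero)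
  qed
qed


section \<open>Deterministic multitape Turing machines\<close>

datatype 'a tape_symbol = Blank | Separator | Input 'a | Work nat

datatype move = Move_Left | Stay | Move_Right

text \<open>
  The transition function maps a state and the list of symbols scanned on the tapes to the new
  state and, for each tape, the symbol written and the head movement.  Tapes are infinite in both
  directions.  States are natural numbers, which loses no generality as there are finitely many.
\<close>

record 'a tm =
  tm_tapes :: nat
  tm_states :: "nat set"
  tm_symbols :: "'a tape_symbol set"
  tm_start :: nat
  tm_accept :: nat
  tm_reject :: nat
  tm_delta :: "nat \<Rightarrow> 'a tape_symbol list \<Rightarrow> nat \<times> ('a tape_symbol \<times> move) list"

definition wf_tm :: "'a set \<Rightarrow> 'a tm \<Rightarrow> bool" where
  "wf_tm S M \<longleftrightarrow>
     tm_tapes M \<ge> 1 \<and> finite (tm_states M) \<and> finite (tm_symbols M) \<and>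
     {Blank, Separator} \<union> Input ` S \<subseteq> tm_symbols M \<and>
     {tm_start M, tm_accept M, tm_reject M} \<subseteq> tm_states M \<and>
     tm_accept M \<noteq> tm_reject M \<and>
     (\<forall>q \<in> tm_states M - {tm_accept M, tm_reject M}. \<forall>ss \<in> lists (tm_symbols M).
        length ss = tm_tapes M \<longrightarrow>
        (case tm_delta M q ss of (q', acts) \<Rightarrow>
           q' \<in> tm_states M \<and> length acts = tm_tapes M \<and> fst ` set acts \<subseteq> tm_symbols M))"

text \<open>A tape consists of the position of its head and its contents.\<close>

type_synonym 'a tape = "int \<times> (int \<Rightarrow> 'a tape_symbol)"

fun act_on_tape :: "'a tape \<Rightarrow> 'a tape_symbol \<times> move \<Rightarrow> 'a tape" where
  "act_on_tape (h, c) (s, d) =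
     (case d of Move_Left \<Rightarrow> h - 1 | Stay \<Rightarrow> h | Move_Right \<Rightarrow> h + 1, c(h := s))"

text \<open>The accepting and the rejecting state are halting states; a halted machine stays put.\<close>

fun tm_step :: "'a tm \<Rightarrow> nat \<times> 'a tape list \<Rightarrow> nat \<times> 'a tape list" where
  "tm_step M (q, ts) =
     (if q \<in> {tm_accept M, tm_reject M} then (q, ts)
      else case tm_delta M q (map (\<lambda>(h, c). c h) ts) of
             (q', acts) \<Rightarrow> (q', map2 act_on_tape ts acts))"

definition tape_of :: "'a tape_symbol list \<Rightarrow> 'a tape" where
  "tape_of w = (0, \<lambda>k. if 0 \<le> k \<and> k < int (length w) then w ! nat k else Blank)"

text \<open>The input words are on the first tape, separated by a marker; all other tapes are empty.\<close>

definition tm_init :: "'a tm \<Rightarrow> 'a list \<Rightarrow> 'a list \<Rightarrow> nat \<times> 'a tape list" where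
  "tm_init M x y =
     (tm_start M,
      tape_of (map Input x @ [Separator] @ map Input y) # replicate (tm_tapes M - 1) (tape_of []))"

definition tm_accepts_within :: "'a tm \<Rightarrow> nat \<Rightarrow> 'a list \<Rightarrow> 'a list \<Rightarrow> bool" where
  "tm_accepts_within M t x y \<longleftrightarrow> fst ((tm_step M ^^ t) (tm_init M x y)) = tm_accept M"

definition tm_rejects_within :: "'a tm \<Rightarrow> nat \<Rightarrow> 'a list \<Rightarrow> 'a list \<Rightarrow> bool" where
  "tm_rejects_within M t x y \<longleftrightarrow> fst ((tm_step M ^^ t) (tm_init M x y)) = tm_reject M"

text \<open>The machine decides the binary relation \<open>rel\<close> on words over \<open>S\<close>, halting after at most
  \<open>T m\<close> steps, where \<open>m\<close> is the larger of the two input lengths.\<close>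

definition tm_decides_in_time ::
    "'a set \<Rightarrow> 'a tm \<Rightarrow> ('a list \<Rightarrow> 'a list \<Rightarrow> bool) \<Rightarrow> (nat \<Rightarrow> nat) \<Rightarrow> bool" where
  "tm_decides_in_time S M rel T \<longleftrightarrow>
     (\<forall>x \<in> lists S. \<forall>y \<in> lists S.
        (rel x y \<longrightarrow> tm_accepts_within M (T (max (length x) (length y))) x y) \<and>
        (\<not> rel x y \<longrightarrow> tm_rejects_within M (T (max (length x) (length y))) x y))"

end

(*
  A nonzero element of the polycyclic monoid is uniquely a b^-1 with words a, b over the generators.
  Let (p, q) be what remains of (a, b) after deleting their longest common prefix.  Then 0 is
  ~p-related to a b^-1 iff p and q are both nonempty, and only 0 is ~c-related to 0.  Nonzero
  elements with remainders (p, q) and (p', q') are ~p-related iff the remainders agree, or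
  q = q' = 1 and p, p' are cyclic conjugates, or p = p' = 1 and q, q' are; for ~c the case
  q = q' = 1 is dropped.

  The remainders are computed with pushdown stacks in linear time.  Cyclic conjugacy of w and v is
  decided in linear time by comparing ww from position i with vv from position j: when the first
  mismatch after k equal letters has the larger letter in ww, the rotations of w starting at
  i, ..., i + k all exceed some rotation of v, so i may jump to i + k + 1 while j stays; moving the
  second head back by k is paid for by the jump.
*)
theory Submission
  imports Defs
begin

section \<open>Structured programs on tapes and their compilation to Turing machines\<close>

text \<open>The asymmetry of ~c comes from conjugators multiplying on the right:
  \<open>g1 g2^-1\<close> lies in P(a b^-1) only if \<open>g1\<close> is a prefix of
  \<open>b\<close>, while \<open>g2\<close> is free. Rotating \<open>q\<close> uses only
  \<open>g2\<close>. Rotating \<open>p\<close> would lengthen \<open>g1\<close> beyond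
  \<open>b\<close>, which is then the bare common prefix.

  The jumps settle cyclic conjugacy because conjugate words have the same rotations, and the least
  of these exceeds none of them; once \<open>i\<close> or \<open>j\<close> has passed all starting
  points, a positive answer is impossible.

  A multitape machine has no registers for \<open>i\<close>, \<open>j\<close>, \<open>k\<close> and
  no random access. Two heads on the doubled words stand at \<open>i + k\<close> and
  \<open>j + k\<close>, and a third head stands at \<open>k\<close> on a copy of \<open>w\<close>.
  Only \<open>k\<close> cells ever have to be walked back, which keeps the total linear.

  The machine must be an explicit object with finitely many states, so the algorithm is a structured
  program, compiled once and for all. Correctness and running time are proved together on the level
  of programs.\<close>

datatype 'a prog =
    Op nat "(nat \<Rightarrow> 'a tape_symbol) \<Rightarrow> 'a tape_symbol" move
  | Seq "'a prog" "'a prog"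
  | Cond "(nat \<Rightarrow> 'a tape_symbol) \<Rightarrow> bool" "'a prog" "'a prog"
  | While "(nat \<Rightarrow> 'a tape_symbol) \<Rightarrow> bool" "'a prog"
  | Done bool

text \<open>Left and right part of a tape, nearest cell first and without trailing blanks (which makes the
  representation unique); the right part starts with the scanned cell.\<close>

type_synonym 'a ztape = "'a tape_symbol list \<times> 'a tape_symbol list"

definition bcons :: "'a tape_symbol \<Rightarrow> 'a tape_symbol list \<Rightarrow> 'a tape_symbol list" where
  "bcons s xs = (if s = Blank \<and> xs = [] then [] else s # xs)"

definition bhd :: "'a tape_symbol list \<Rightarrow> 'a tape_symbol" where
  "bhd xs = (case xs of [] \<Rightarrow> Blank | x # _ \<Rightarrow> x)"

definition bnth :: "'a tape_symbol list \<Rightarrow> nat \<Rightarrow> 'a tape_symbol" where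
  "bnth xs i = (if i < length xs then xs ! i else Blank)"

fun ztape_act :: "'a tape_symbol \<Rightarrow> move \<Rightarrow> 'a ztape \<Rightarrow> 'a ztape" where
  "ztape_act s Move_Left (l, r) = (tl l, bcons (bhd l) (bcons s (tl r)))"
| "ztape_act s Stay (l, r) = (l, bcons s (tl r))"
| "ztape_act s Move_Right (l, r) = (bcons s l, tl r)"

definition scan :: "(nat \<Rightarrow> 'a ztape) \<Rightarrow> nat \<Rightarrow> 'a tape_symbol" where
  "scan Z i = bhd (snd (Z i))"

text \<open>The control state is the list of programs still to be run.\<close>

fun next_ctl :: "'a prog list \<Rightarrow> (nat \<Rightarrow> 'a tape_symbol) \<Rightarrow>
    'a prog list \<times> (nat \<times> 'a tape_symbol \<times> move) option" where
  "next_ctl [] rd = ([], None)"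
| "next_ctl (Op i f m # k) rd = (k, Some (i, f rd, m))"
| "next_ctl (Seq p q # k) rd = (p # q # k, None)"
| "next_ctl (Cond c p q # k) rd = ((if c rd then p else q) # k, None)"
| "next_ctl (While c p # k) rd = ((if c rd then p # While c p # k else k), None)"
| "next_ctl (Done b # k) rd = ([Done b], None)"

fun zstep :: "'a prog list \<times> (nat \<Rightarrow> 'a ztape) \<Rightarrow> 'a prog list \<times> (nat \<Rightarrow> 'a ztape)" where
  "zstep (s, Z) = (case next_ctl s (scan Z) of
      (s', None) \<Rightarrow> (s', Z)
    | (s', Some (i, a, m)) \<Rightarrow> (s', Z(i := ztape_act a m (Z i))))"

text \<open>Since \<open>[Done b]\<close> is a fixed point of \<open>zstep\<close>, "after
  \<open>t\<close> steps" amounts to "within \<open>t\<close> steps", so estimates may be rounded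
  up. Specifications below are in continuation style: if \<open>k\<close> halts within
  \<open>t\<close> from the tapes left by \<open>p\<close>, then \<open>p # k\<close> halts within
  \<open>t\<close> plus the cost of \<open>p\<close>.\<close>

definition halts :: "'a prog list \<Rightarrow> (nat \<Rightarrow> 'a ztape) \<Rightarrow> bool \<Rightarrow> nat \<Rightarrow> bool" where
  "halts s Z b t \<longleftrightarrow> fst ((zstep ^^ t) (s, Z)) = [Done b]"

lemma zstep_Done_pow: "(zstep ^^ t) ([Done b], Z) = ([Done b], Z)"
  by (induction t) auto

lemma halts_mono: "halts s Z b t \<Longrightarrow> t \<le> t' \<Longrightarrow> halts s Z b t'"
proof -
  assume a: "halts s Z b t" "t \<le> t'"
  obtain Z' where "(zstep ^^ t) (s, Z) = ([Done b], Z')"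
    using a(1) by (cases "(zstep ^^ t) (s, Z)") (simp add: halts_def)
  moreover have "(zstep ^^ t') (s, Z) = (zstep ^^ (t' - t)) ((zstep ^^ t) (s, Z))"
    using a(2) fun_cong[OF funpow_add[of "t' - t" t zstep], of "(s, Z)"] by (simp del: split_paired_All)
  ultimately show ?thesis by (simp add: halts_def zstep_Done_pow)
qed

lemma halts_Suc: "halts s Z b (Suc t) \<longleftrightarrow> halts (fst (zstep (s, Z))) (snd (zstep (s, Z))) b t"
  by (simp add: halts_def funpow_swap1 del: zstep.simps)

lemma halts_Op: "halts (Op i f m # k) Z b (Suc t) \<longleftrightarrow> halts k (Z(i := ztape_act (f (scan Z)) m (Z i))) b t"
  by (simp add: halts_Suc)

lemma halts_Seq: "halts (Seq p q # k) Z b (Suc t) \<longleftrightarrow> halts (p # q # k) Z b t"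
  by (simp add: halts_Suc)

lemma halts_Cond: "halts (Cond c p q # k) Z b (Suc t) \<longleftrightarrow> halts ((if c (scan Z) then p else q) # k) Z b t"
  by (simp add: halts_Suc)

lemma halts_While: "halts (While c p # k) Z b (Suc t) \<longleftrightarrow>
    (if c (scan Z) then halts (p # While c p # k) Z b t else halts k Z b t)"
  by (simp add: halts_Suc)

lemma halts_Done: "halts (Done b' # k) Z b (Suc t) \<longleftrightarrow> b' = b"
  by (simp add: halts_Suc) (simp add: halts_def zstep_Done_pow)

lemmas halts_simps = halts_Op halts_Seq halts_Cond halts_While halts_Done

text \<open>All control states that can occur before \<open>p # k\<close> is left with \<open>k\<close> remaining.  This set is
  finite although loops push themselves onto \<open>k\<close>.\<close>

fun conts :: "'a prog \<Rightarrow> 'a prog list \<Rightarrow> 'a prog list set" where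
  "conts (Op i f m) k = {Op i f m # k}"
| "conts (Seq p q) k = insert (Seq p q # k) (conts p (q # k) \<union> conts q k)"
| "conts (Cond c p q) k = insert (Cond c p q # k) (conts p k \<union> conts q k)"
| "conts (While c p) k = insert (While c p # k) (conts p (While c p # k))"
| "conts (Done b) k = {Done b # k}"

lemma finite_conts: "finite (conts p k)"
  by (induction p arbitrary: k) auto

lemma conts_start: "p # k \<in> conts p k"
  by (cases p) auto

text \<open>A subprogram exits to the continuation it was given. For \<open>Seq\<close> and
  \<open>While\<close> this continuation (\<open>q # k\<close>, or the loop itself on top of
  \<open>k\<close>) already belongs to the set, so only \<open>k\<close> and the halting states lie
  outside.\<close>

lemma conts_closed:
  "s \<in> conts p k \<Longrightarrow> fst (next_ctl s rd) \<in> conts p k \<union> {k, [Done True], [Done False]}"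
proof (induction p arbitrary: k)
  case (Done b)
  then show ?case by (cases b) auto
next
  case (Seq p q)
  then consider "s = Seq p q # k" | "s \<in> conts p (q # k)" | "s \<in> conts q k" by auto
  then show ?case
    using Seq.IH(1)[of "q # k"] Seq.IH(2)[of k] by cases (auto simp: conts_start)
next
  case (Cond c p q)
  then consider "s = Cond c p q # k" | "s \<in> conts p k" | "s \<in> conts q k" by auto
  then show ?case
    using Cond.IH(1)[of k] Cond.IH(2)[of k] by cases (auto simp: conts_start)
next
  case (While c p)
  then consider "s = While c p # k" | "s \<in> conts p (While c p # k)" by auto
  then show ?case
    using While.IH[of "While c p # k"] by cases (auto simp: conts_start)
qed auto

fun wf_prog :: "'a tape_symbol set \<Rightarrow> nat \<Rightarrow> 'a prog \<Rightarrow> bool" where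
  "wf_prog G K (Op i f m) \<longleftrightarrow> i < K \<and> (\<forall>rd. range rd \<subseteq> G \<longrightarrow> f rd \<in> G)"
| "wf_prog G K (Seq p q) \<longleftrightarrow> wf_prog G K p \<and> wf_prog G K q"
| "wf_prog G K (Cond c p q) \<longleftrightarrow> wf_prog G K p \<and> wf_prog G K q"
| "wf_prog G K (While c p) \<longleftrightarrow> wf_prog G K p"
| "wf_prog G K (Done b) \<longleftrightarrow> True"

lemma wf_prog_conts:
  "wf_prog G K p \<Longrightarrow> list_all (wf_prog G K) k \<Longrightarrow> s \<in> conts p k \<Longrightarrow> list_all (wf_prog G K) s"
proof (induction p arbitrary: k)
  case (Seq p q)
  then show ?case using Seq.IH(1)[of "q # k"] Seq.IH(2)[of k] by auto
next
  case (While c p)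
  then show ?case using While.IH[of "While c p # k"] by auto
qed auto

lemma next_ctl_wf:
  assumes "list_all (wf_prog G K) s" "next_ctl s rd = (s', Some (i, a, m))"
  shows "i < K" "range rd \<subseteq> G \<Longrightarrow> a \<in> G"
  using assms by (induction s rd rule: next_ctl.induct) auto

text \<open>\<open>[]\<close> is where a program ends that runs out without \<open>Done\<close>; it
  stays there. The two halting states are added in any case, since a machine must have both an
  accepting and a rejecting state.\<close>

definition prog_states :: "'a prog \<Rightarrow> 'a prog list set" where
  "prog_states p = conts p [] \<union> {[], [Done True], [Done False]}"

lemma next_ctl_prog_states: "s \<in> prog_states p \<Longrightarrow> fst (next_ctl s rd) \<in> prog_states p"
  using conts_closed[of s p "[]" rd] by (auto simp: prog_states_def)

text \<open>Programs read a function on all indices, machines a list of \<open>K\<close> symbols.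
  The default \<open>Blank\<close> agrees with \<open>scan\<close> because \<open>sim\<close> keeps
  every tape from \<open>K\<close> on empty.\<close>

definition reads :: "nat \<Rightarrow> 'a tape_symbol list \<Rightarrow> nat \<Rightarrow> 'a tape_symbol" where
  "reads K ss i = (if i < K then ss ! i else Blank)"

definition prog_enc :: "'a prog \<Rightarrow> 'a prog list \<Rightarrow> nat" where
  "prog_enc p = (SOME f. inj_on f (prog_states p))"

lemma inj_prog_enc: "inj_on (prog_enc p) (prog_states p)"
proof -
  have "finite (prog_states p)" by (simp add: prog_states_def finite_conts)
  then obtain f :: "'a prog list \<Rightarrow> nat" where "inj_on f (prog_states p)"
    using finite_imp_inj_to_nat_seg by blast
  then show ?thesis
    unfolding prog_enc_def using someI[of "\<lambda>f. inj_on f (prog_states p)" f] by blast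
qed

definition prog_tm :: "'a tape_symbol set \<Rightarrow> nat \<Rightarrow> 'a prog \<Rightarrow> 'a tm" where
  "prog_tm G K p = \<lparr>tm_tapes = K, tm_states = prog_enc p ` prog_states p, tm_symbols = G,
     tm_start = prog_enc p [p], tm_accept = prog_enc p [Done True],
     tm_reject = prog_enc p [Done False],
     tm_delta = (\<lambda>q ss. case next_ctl (inv_into (prog_states p) (prog_enc p) q) (reads K ss) of (s', a) \<Rightarrow>
        (prog_enc p s', map (\<lambda>i. case a of None \<Rightarrow> (ss ! i, Stay)
           | Some (j, x, m) \<Rightarrow> if i = j then (x, m) else (ss ! i, Stay)) [0..<K]))\<rparr>"

lemma Done_in_prog_states: "[Done b] \<in> prog_states p"
  by (cases b) (auto simp: prog_states_def)

lemma prog_enc_eq_iff: "s \<in> prog_states p \<Longrightarrow> s' \<in> prog_states p \<Longrightarrow> prog_enc p s = prog_enc p s' \<longleftrightarrow> s = s'"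
  using inj_prog_enc by (metis inj_on_eq_iff)

lemma wf_prog_states: "wf_prog G K p \<Longrightarrow> s \<in> prog_states p \<Longrightarrow> list_all (wf_prog G K) s"
  using wf_prog_conts[of G K p "[]" s] by (auto simp: prog_states_def)

lemma wf_prog_tm:
  assumes "wf_prog G K p" "K \<ge> 1" "finite G" "{Blank, Separator} \<union> Input ` S \<subseteq> G"
  shows "wf_tm S (prog_tm G K p)"
proof -
  have fin: "finite (prog_states p)" by (simp add: prog_states_def finite_conts)
  have delta: "case tm_delta (prog_tm G K p) q ss of (q', acts) \<Rightarrow>
      q' \<in> prog_enc p ` prog_states p \<and> length acts = K \<and> fst ` set acts \<subseteq> G"
    if "q \<in> prog_enc p ` prog_states p" "ss \<in> lists G" "length ss = K" for q ss
  proof -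
    from that(1) obtain s where s: "s \<in> prog_states p" "q = prog_enc p s" by auto
    obtain s' a where n: "next_ctl s (reads K ss) = (s', a)" by fastforce
    have "s' \<in> prog_states p" using next_ctl_prog_states[OF s(1)] n by (metis fst_conv)
    moreover have "range (reads K ss) \<subseteq> G"
      using that assms(4) by (auto simp: reads_def in_lists_conv_set)
    moreover have "ss ! i \<in> G" if "i < K" for i
      using \<open>ss \<in> lists G\<close> \<open>length ss = K\<close> that by auto
    ultimately show ?thesis
      using next_ctl_wf(2)[OF wf_prog_states[OF assms(1) s(1)]] n s inj_prog_enc[of p]
      by (auto simp: prog_tm_def split: option.splits)
  qed
  show ?thesis
    unfolding wf_tm_def
  proof (intro conjI ballI impI)
    show "tm_tapes (prog_tm G K p) \<ge> 1" "finite (tm_states (prog_tm G K p))"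
      "finite (tm_symbols (prog_tm G K p))"
      "{Blank, Separator} \<union> Input ` S \<subseteq> tm_symbols (prog_tm G K p)"
      using assms fin by (simp_all add: prog_tm_def)
    show "{tm_start (prog_tm G K p), tm_accept (prog_tm G K p), tm_reject (prog_tm G K p)}
        \<subseteq> tm_states (prog_tm G K p)"
      using conts_start[of p "[]"] by (simp add: prog_tm_def prog_states_def)
    show "tm_accept (prog_tm G K p) \<noteq> tm_reject (prog_tm G K p)"
      by (simp add: prog_tm_def prog_enc_eq_iff Done_in_prog_states)
    fix q ss
    assume "q \<in> tm_states (prog_tm G K p) - {tm_accept (prog_tm G K p), tm_reject (prog_tm G K p)}"
      "ss \<in> lists (tm_symbols (prog_tm G K p))" "length ss = tm_tapes (prog_tm G K p)"
    then have "q \<in> prog_enc p ` prog_states p" "ss \<in> lists G" "length ss = K"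
      by (simp_all add: prog_tm_def)
    from delta[OF this] show "case tm_delta (prog_tm G K p) q ss of (q', acts) \<Rightarrow>
        q' \<in> tm_states (prog_tm G K p) \<and> length acts = tm_tapes (prog_tm G K p) \<and>
        fst ` set acts \<subseteq> tm_symbols (prog_tm G K p)"
      by (simp add: prog_tm_def)
  qed
qed

section \<open>Step-by-step simulation of a program by its machine\<close>

fun tape_rep :: "'a ztape \<Rightarrow> 'a tape \<Rightarrow> bool" where
  "tape_rep (l, r) (h, c) \<longleftrightarrow>
     (\<forall>i. c (h + int i) = bnth r i \<and> c (h - 1 - int i) = bnth l i)"

lemma bnth_simps:
  "bnth (bcons s xs) 0 = s" "bnth (bcons s xs) (Suc i) = bnth xs i" "bnth (tl xs) i = bnth xs (Suc i)"
  "bnth xs 0 = bhd xs" "bhd (bcons s xs) = s"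
  by (cases xs; auto simp: bnth_def bcons_def bhd_def nth_tl)+

lemma tape_rep_scan: "tape_rep z (h, c) \<Longrightarrow> c h = bhd (snd z)"
  by (cases z) (metis add.right_neutral bnth_simps(4) of_nat_0 snd_conv tape_rep.simps)

lemma tape_rep_act:
  assumes "tape_rep z t"
  shows "tape_rep (ztape_act s m z) (act_on_tape t (s, m))"
proof -
  obtain l r h c where zt [simp]: "z = (l, r)" "t = (h, c)" by (cases z, cases t)
  have P: "c (h + int i) = bnth r i" and Q: "c (h - 1 - int i) = bnth l i" for i
    using assms by auto
  show ?thesis
  proof (cases m)
    case Move_Left
    have "(c(h := s)) (h - 1 + int i) = bnth (bcons (bhd l) (bcons s (tl r))) i" for i
    proof (cases i)
      case 0
      then show ?thesis using Q[of 0] by (simp add: bnth_simps)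
    next
      case (Suc j)
      then show ?thesis using P[of j] by (cases j) (simp_all add: bnth_simps algebra_simps)
    qed
    moreover have "(c(h := s)) (h - 1 - 1 - int i) = bnth (tl l) i" for i
      using Q[of "Suc i"] by (simp add: bnth_simps algebra_simps)
    ultimately show ?thesis using Move_Left by simp
  next
    case Stay
    have "(c(h := s)) (h + int i) = bnth (bcons s (tl r)) i" for i
      using P[of i] by (cases i) (simp_all add: bnth_simps)
    then show ?thesis using Stay Q by simp
  next
    case Move_Right
    have "(c(h := s)) (h + 1 + int i) = bnth (tl r) i" for i
      using P[of "Suc i"] by (simp add: bnth_simps algebra_simps)
    moreover have "(c(h := s)) (h + 1 - 1 - int i) = bnth (bcons s l) i" for i
    proof (cases i)
      case (Suc j)
      then show ?thesis using Q[of j] by (simp add: bnth_simps algebra_simps)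
    qed (simp add: bnth_simps)
    ultimately show ?thesis using Move_Right by simp
  qed
qed

text \<open>A machine acts on all tapes at once, a program on at most one; the idle tapes get their
  scanned symbol written back.\<close>

lemma tape_rep_stay: "tape_rep z (h, c) \<Longrightarrow> tape_rep z (act_on_tape (h, c) (c h, Stay))"
  by (cases z) simp

lemma tape_rep_tape_of: "tape_rep ([], w) (tape_of w)"
  by (auto simp: tape_of_def bnth_def)

fun sim :: "nat \<Rightarrow> 'a prog \<Rightarrow> 'a prog list \<times> (nat \<Rightarrow> 'a ztape) \<Rightarrow> nat \<times> 'a tape list \<Rightarrow> bool" where
  "sim K p (s, Z) (q, ts) \<longleftrightarrow> s \<in> prog_states p \<and> q = prog_enc p s \<and> length ts = K \<and>
     (\<forall>i<K. tape_rep (Z i) (ts ! i)) \<and> (\<forall>i\<ge>K. Z i = ([], []))"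

lemma sim_step:
  assumes "wf_prog G K p" "sim K p (s, Z) (q, ts)"
  shows "sim K p (zstep (s, Z)) (tm_step (prog_tm G K p) (q, ts))"
proof (cases "s = [Done True] \<or> s = [Done False]")
  case True
  then show ?thesis using assms(2) by (auto simp: prog_tm_def)
next
  case False
  have s: "s \<in> prog_states p" "q = prog_enc p s" "length ts = K"
    and rep: "\<And>i. i < K \<Longrightarrow> tape_rep (Z i) (ts ! i)" and bl: "\<And>i. i \<ge> K \<Longrightarrow> Z i = ([], [])"
    using assms(2) by auto
  have q: "q \<noteq> prog_enc p [Done True]" "q \<noteq> prog_enc p [Done False]"
    using False s by (auto simp: prog_enc_eq_iff Done_in_prog_states)
  define ss where "ss = map (\<lambda>(h, c). c h) ts"
  have ssi: "ss ! i = (case ts ! i of (h, c) \<Rightarrow> c h)" "ss ! i = scan Z i" if "i < K" for i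
    using tape_rep_scan[of "Z i"] rep[OF that] that s(3)
    by (auto simp: ss_def scan_def split: prod.splits)
  have rd: "reads K ss = scan Z"
    using ssi(2) bl by (auto simp: fun_eq_iff reads_def scan_def bhd_def)
  obtain s' a where n: "next_ctl s (scan Z) = (s', a)" by fastforce
  have s': "s' \<in> prog_states p" using next_ctl_prog_states[OF s(1)] n by (metis fst_conv)
  have inv: "inv_into (prog_states p) (prog_enc p) q = s"
    using inv_into_f_f[OF inj_prog_enc s(1)] s(2) by simp
  define acts where "acts = map (\<lambda>i. case a of None \<Rightarrow> (ss ! i, Stay)
           | Some (j, x, m) \<Rightarrow> if i = j then (x, m) else (ss ! i, Stay)) [0..<K]"
  have tms: "tm_step (prog_tm G K p) (q, ts) = (prog_enc p s', map2 act_on_tape ts acts)"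
    using q n inv rd by (simp add: prog_tm_def ss_def[symmetric] acts_def)
  have nth: "map2 act_on_tape ts acts ! i = act_on_tape (ts ! i) (acts ! i)" if "i < K" for i
    using that s(3) by (simp add: acts_def)
  have stay: "tape_rep (Z i) (act_on_tape (ts ! i) (ss ! i, Stay))" if "i < K" for i
    using rep[OF that] ssi(1)[OF that] tape_rep_stay by (metis case_prod_conv surj_pair)
  have len: "length (map2 act_on_tape ts acts) = K" using s(3) by (simp add: acts_def)
  show ?thesis
  proof (cases a)
    case None
    have "tape_rep (Z i) (map2 act_on_tape ts acts ! i)" if "i < K" for i
      unfolding nth[OF that] using stay[OF that] that None by (simp add: acts_def)
    then show ?thesis unfolding tms using n None s' len bl by simp
  next
    case (Some jxm)
    obtain j x m where a: "a = Some (j, x, m)" using Some by (metis surj_pair)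
    have j: "j < K" using next_ctl_wf(1)[OF wf_prog_states[OF assms(1) s(1)]] n a by metis
    have "tape_rep ((Z(j := ztape_act x m (Z j))) i) (map2 act_on_tape ts acts ! i)" if "i < K" for i
      unfolding nth[OF that] using stay[OF that] that a tape_rep_act[OF rep[OF that]]
      by (cases "i = j") (simp_all add: acts_def)
    then show ?thesis unfolding tms using n a s' len bl j by simp
  qed
qed

lemma sim_steps:
  assumes "wf_prog G K p" "sim K p c d"
  shows "sim K p ((zstep ^^ t) c) ((tm_step (prog_tm G K p) ^^ t) d)"
proof (induction t)
  case (Suc t)
  obtain s Z q ts where "(zstep ^^ t) c = (s, Z)" "(tm_step (prog_tm G K p) ^^ t) d = (q, ts)"
    by fastforce
  then show ?case
    using sim_step[OF assms(1), of s Z q ts] Suc by (simp del: zstep.simps tm_step.simps sim.simps)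
qed (use assms in simp)

definition input_tapes :: "'a list \<Rightarrow> 'a list \<Rightarrow> nat \<Rightarrow> 'a ztape" where
  "input_tapes x y = (\<lambda>_. ([], []))(0 := ([], map Input x @ [Separator] @ map Input y))"

lemma prog_tm_decides:
  assumes wf: "wf_prog G K p" and K: "K \<ge> 1"
    and halts: "\<And>x y. x \<in> lists S \<Longrightarrow> y \<in> lists S \<Longrightarrow>
       halts [p] (input_tapes x y) (rel x y) (T (max (length x) (length y)))"
  shows "tm_decides_in_time S (prog_tm G K p) rel T"
proof -
  have "fst ((tm_step (prog_tm G K p) ^^ t) (tm_init (prog_tm G K p) x y)) = prog_enc p [Done b]"
    if "halts [p] (input_tapes x y) b t" for x y b t
  proof -
    have "tape_rep ([], []) (tape_of [])" by (rule tape_rep_tape_of)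
    then have "sim K p ([p], input_tapes x y) (tm_init (prog_tm G K p) x y)"
      using K conts_start[of p "[]"] tape_rep_tape_of[of "map Input x @ [Separator] @ map Input y"]
      by (auto simp: tm_init_def prog_tm_def input_tapes_def prog_states_def nth_Cons'
          simp del: tape_rep.simps)
    from sim_steps[OF wf this, of t]
    have "sim K p ((zstep ^^ t) ([p], input_tapes x y))
       ((tm_step (prog_tm G K p) ^^ t) (tm_init (prog_tm G K p) x y))" .
    moreover obtain s Z where "(zstep ^^ t) ([p], input_tapes x y) = (s, Z)" by fastforce
    moreover obtain q ts where
      "(tm_step (prog_tm G K p) ^^ t) (tm_init (prog_tm G K p) x y) = (q, ts)" by fastforce
    ultimately show ?thesis using that by (simp add: halts_def)
  qed
  note run = this
  have sel: "tm_accept (prog_tm G K p) = prog_enc p [Done True]"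
    "tm_reject (prog_tm G K p) = prog_enc p [Done False]"
    by (simp_all add: prog_tm_def)
  show ?thesis
    unfolding tm_decides_in_time_def tm_accepts_within_def tm_rejects_within_def sel
  proof (intro ballI conjI impI)
    fix x y assume xy: "x \<in> lists S" "y \<in> lists S"
    show "fst ((tm_step (prog_tm G K p) ^^ T (max (length x) (length y)))
        (tm_init (prog_tm G K p) x y)) = prog_enc p [Done True]" if "rel x y"
      using run[OF halts[OF xy]] that by simp
    show "fst ((tm_step (prog_tm G K p) ^^ T (max (length x) (length y)))
        (tm_init (prog_tm G K p) x y)) = prog_enc p [Done False]" if "\<not> rel x y"
      using run[OF halts[OF xy]] that by simp
  qed
qed

section \<open>Normal forms and conjugacy in the polycyclic monoid\<close>

fun strip :: "'a list \<Rightarrow> 'a list \<Rightarrow> 'a list \<times> 'a list" where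
  "strip (x # xs) (y # ys) = (if x = y then strip xs ys else (x # xs, y # ys))"
| "strip xs ys = (xs, ys)"

lemma strip_Nil [simp]: "strip [] ys = ([], ys)" "strip xs [] = (xs, [])"
  by (cases xs; simp)+

lemma strip_append_same [simp]: "strip (e @ xs) (e @ ys) = strip xs ys"
  by (induction e) auto

lemma strip_same_append [simp]: "strip e (e @ ys) = ([], ys)" "strip (e @ xs) e = (xs, [])"
  using strip_append_same[of e "[]" ys] strip_append_same[of e xs "[]"] by simp_all

lemma strip_self [simp]: "strip e e = ([], [])"
  using strip_same_append(1)[of e "[]"] by simp

lemma strip_append_right:
  "strip xs (ys @ zs) = (case strip xs ys of (p, q) \<Rightarrow> if q = [] then strip p zs else (p, q @ zs))"
  by (induction xs ys rule: strip.induct) auto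

lemma stripE:
  obtains e p q where "xs = e @ p" "ys = e @ q" "strip xs ys = (p, q)" "p = [] \<or> q = [] \<or> hd p \<noteq> hd q"
proof -
  have "\<exists>e p q. xs = e @ p \<and> ys = e @ q \<and> strip xs ys = (p, q) \<and> (p = [] \<or> q = [] \<or> hd p \<noteq> hd q)"
  proof (induction xs ys rule: strip.induct)
    case (1 x xs y ys)
    show ?case
    proof (cases "x = y")
      case True
      then obtain e p q where "xs = e @ p \<and> ys = e @ q \<and> strip xs ys = (p, q) \<and>
          (p = [] \<or> q = [] \<or> hd p \<noteq> hd q)" using 1 by blast
      then show ?thesis using True by (rule_tac exI[of _ "x # e"], rule_tac exI[of _ p], rule_tac exI[of _ q]) auto
    qed auto
  qed auto
  then show ?thesis using that by blast
qed

lemma strip_eq: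
  "p = [] \<or> q = [] \<or> hd p \<noteq> hd q \<Longrightarrow> strip p q = (p, q)"
  by (cases p; cases q) auto

definition cyclic :: "'a list \<Rightarrow> 'a list \<Rightarrow> bool" where
  "cyclic xs ys \<longleftrightarrow> (\<exists>s t. xs = s @ t \<and> ys = t @ s)"

lemma cyclicI [intro?]: "cyclic (s @ t) (t @ s)"
  by (auto simp: cyclic_def)

lemma cyclic_sym: "cyclic xs ys \<Longrightarrow> cyclic ys xs"
  by (auto simp: cyclic_def)

lemma cyclic_refl [simp]: "cyclic xs xs"
  unfolding cyclic_def by (rule exI[of _ xs], rule exI[of _ "[]"]) simp

lemma cyclic_length: "cyclic xs ys \<Longrightarrow> length xs = length ys"
  by (auto simp: cyclic_def)

text \<open>The classical conjugacy equation for words. A long \<open>t\<close> starts with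
  \<open>r\<close>, and cancelling \<open>r\<close> leaves the same equation for a shorter
  \<open>t\<close> (hence the separate case of empty \<open>r\<close>). Otherwise
  \<open>r = t @ e\<close>, which forces \<open>s = e @ t\<close>.\<close>

lemma intertwined_cyclic: "t @ s = r @ t \<Longrightarrow> cyclic s r"
proof (induction "length t" arbitrary: t rule: less_induct)
  case less
  show ?case
  proof (cases "r = []")
    case True
    then show ?thesis using less.prems by simp
  next
    case r: False
    from less.prems consider t' where "t = r @ t'" "t' @ s = t"
      | e where "r = t @ e" "s = e @ t"
      by (auto simp: append_eq_append_conv2)
    then show ?thesis
    proof cases
      case 1
      then show ?thesis using less.hyps[of t'] r by simp
    next
      case 2
      then show ?thesis by (simp add: cyclicI)
    qed
  qed
qed

text \<open>\<open>Some (a, b)\<close> stands for \<open>a b\<^sup>-\<^sup>1\<close> and \<open>None\<close> for zero.\<close>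

type_synonym nform = "(nat list \<times> nat list) option"

text \<open>Right multiplication by one letter. As \<open>(j b)^-1 = b^-1 j^-1\<close>, the letter
  next to the new one is the head of \<open>b\<close>; this makes \<open>b\<close> a stack.\<close>

fun nf_step :: "nform \<Rightarrow> letter \<Rightarrow> nform" where
  "nf_step None _ = None"
| "nf_step (Some (a, b)) Zero = None"
| "nf_step (Some (a, b)) (Inv j) = Some (a, j # b)"
| "nf_step (Some (a, b)) (Gen j) = (case b of [] \<Rightarrow> Some (a @ [j], [])
     | k # b' \<Rightarrow> if k = j then Some (a, b') else None)"

definition nf :: "letter list \<Rightarrow> nform" where
  "nf w = foldl nf_step (Some ([], [])) w"

fun nf_mult :: "nform \<Rightarrow> nform \<Rightarrow> nform" where
  "nf_mult (Some (a, b)) (Some (c, d)) = (case strip b c of (p, q) \<Rightarrow>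
     if p = [] then Some (a @ q, d) else if q = [] then Some (a, d @ p) else None)"
| "nf_mult None _ = None"
| "nf_mult _ None = None"

lemma nf_mult_None [simp]: "nf_mult s None = None"
  by (cases s) auto

lemma foldl_nf_step_None [simp]: "foldl nf_step None w = None"
  by (induction w) auto

text \<open>The instance of associativity that makes \<open>nf\<close> multiplicative, by induction
  on the second word.\<close>

lemma nf_step_mult: "nf_step (nf_mult s t) x = nf_mult s (nf_step t x)"
proof (cases s)
  case s: (Some ab)
  obtain a b where ab: "ab = (a, b)" by (cases ab)
  show ?thesis
  proof (cases t)
    case t: (Some cd)
    obtain c d where cd: "cd = (c, d)" by (cases cd)
    obtain p q where pq: "strip b c = (p, q)" by fastforce
    show ?thesis
    proof (cases x)
      case (Gen j)
      then show ?thesis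
        by (cases d; cases p; cases q) (auto simp: s t ab cd pq strip_append_right)
    qed (auto simp: s t ab cd pq)
  qed auto
qed auto

lemma nf_mult_foldl: "foldl nf_step (nf_mult s t) w = nf_mult s (foldl nf_step t w)"
  by (induction w arbitrary: t) (auto simp: nf_step_mult)

lemma nf_mult_one [simp]: "nf_mult s (Some ([], [])) = s"
  by (cases s) (auto split: prod.splits simp: strip_Nil)

lemma nf_mult_one_left [simp]: "nf_mult (Some ([], [])) s = s"
  by (cases s) auto

lemma nf_append: "nf (u @ v) = nf_mult (nf u) (nf v)"
  using nf_mult_foldl[of "nf u" "Some ([], [])" v] by (simp add: nf_def)

definition valid :: "nat \<Rightarrow> nform \<Rightarrow> bool" where
  "valid n s \<longleftrightarrow> (\<forall>a b. s = Some (a, b) \<longrightarrow> set a \<subseteq> {1..n} \<and> set b \<subseteq> {1..n})"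

lemma valid_simps [simp]: "valid n None" 
  "valid n (Some (a, b)) \<longleftrightarrow> set a \<subseteq> {1..n} \<and> set b \<subseteq> {1..n}"
  by (auto simp: valid_def)

fun nf_word :: "nform \<Rightarrow> letter list" where
  "nf_word None = [Zero]"
| "nf_word (Some (a, b)) = map Gen a @ map Inv (rev b)"

lemma valid_nf_step: "valid n s \<Longrightarrow> x \<in> polycyclic_letters n \<Longrightarrow> valid n (nf_step s x)"
  by (cases "(s, x)" rule: nf_step.cases) (auto simp: polycyclic_letters_def split: list.splits)

lemma valid_nf: "w \<in> lists (polycyclic_letters n) \<Longrightarrow> valid n (nf w)"
  by (induction w rule: rev_induct) (auto simp: nf_def valid_nf_step)

lemma nf_word_in_lists: "valid n s \<Longrightarrow> nf_word s \<in> lists (polycyclic_letters n)"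
  by (cases s rule: nf_word.cases) (auto simp: polycyclic_letters_def image_iff subset_iff)

lemma foldl_nf_step_Inv: "foldl nf_step (Some (a, b)) (map Inv w) = Some (a, rev w @ b)"
  by (induction w arbitrary: b) auto

lemma foldl_nf_step_Gen: "foldl nf_step (Some (a, [])) (map Gen w) = Some (a @ w, [])"
  by (induction w arbitrary: a) auto

lemma nf_nf_word [simp]: "nf (nf_word s) = s"
  by (cases s rule: nf_word.cases) (simp_all add: nf_def foldl_nf_step_Gen foldl_nf_step_Inv)

section \<open>Existence and uniqueness of normal forms in the presented monoid\<close>

abbreviation pcong :: "nat \<Rightarrow> (letter list \<times> letter list) set" where
  "pcong n \<equiv> pres_cong (polycyclic_letters n) (polycyclic_rels n)"

text \<open>Letters act on normal forms, and both sides of each relation act alike. Hence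
  \<open>nf\<close> is constant on congruence classes, and normal forms are unique without any
  confluence argument.\<close>

lemma rel_foldl: "(l, r) \<in> polycyclic_rels n \<Longrightarrow> foldl nf_step s l = foldl nf_step s r"
  by (cases s) (auto simp: polycyclic_rels_def split: list.splits)

lemma pcong_nf: "(u, v) \<in> pcong n \<Longrightarrow> nf u = nf v"
proof (induction rule: pres_cong.induct)
  case (rel l r u v)
  then show ?case using rel_foldl[of l r n "nf u"] by (simp add: nf_def)
qed auto

lemma pcong_nf_step:
  assumes "valid n s" "x \<in> polycyclic_letters n"
  shows "(nf_word s @ [x], nf_word (nf_step s x)) \<in> pcong n"
proof (cases s)
  case None
  then show ?thesis using pres_cong_Zero(2)[of "[x]" n] assms by simp
next
  case (Some ab)
  obtain a b where ab: "ab = (a, b)" by (cases ab)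
  note sab = Some ab
  have pl: "nf_word s \<in> lists (polycyclic_letters n)" using assms(1) by (rule nf_word_in_lists)
  show ?thesis
  proof (cases x)
    case Zero
    then show ?thesis using pres_cong_Zero(1)[OF pl] sab by simp
  next
    case (Inv j)
    have "nf_word s @ [x] = nf_word (nf_step s x)" using sab Inv by simp
    moreover have "nf_word s @ [x] \<in> lists (polycyclic_letters n)" using pl assms(2) by simp
    ultimately show ?thesis by (metis pres_cong.refl)
  next
    case (Gen j)
    have j: "j \<in> {1..n}" using assms(2) Gen by (auto simp: polycyclic_letters_def)
    show ?thesis
    proof (cases b)
      case Nil
      have "nf_word s @ [x] = nf_word (nf_step s x)" using sab Gen Nil by simp
      moreover have "nf_word s @ [x] \<in> lists (polycyclic_letters n)" using pl assms(2) by simp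
      ultimately show ?thesis by (metis pres_cong.refl)
    next
      case (Cons k b')
      define w where "w = nf_word (Some (a, b'))"
      have eq: "nf_word s @ [x] = w @ [Inv k, Gen j] @ []" using sab Gen Cons by (simp add: w_def)
      have k: "k \<in> {1..n}" using assms(1) sab Cons by simp
      have w: "w \<in> lists (polycyclic_letters n)"
        unfolding w_def using assms(1) sab Cons by (intro nf_word_in_lists) simp
      have l: "[Inv k, Gen j] \<in> lists (polycyclic_letters n)" "[Zero] \<in> lists (polycyclic_letters n)"
        using j k by (auto simp: polycyclic_letters_def)
      show ?thesis
      proof (cases "k = j")
        case True
        have "([Inv k, Gen j], []) \<in> polycyclic_rels n"
          using j True by (auto simp: polycyclic_rels_def)
        from pres_cong.rel[OF this l(1) _ w, of "[]"] show ?thesis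
          using sab Gen Cons True by (simp add: w_def)
      next
        case False
        have "([Inv k, Gen j], [Zero]) \<in> polycyclic_rels n"
          using j k False by (auto simp: polycyclic_rels_def)
        from pres_cong.rel[OF this l w, of "[]"]
        have "(w @ [Inv k, Gen j], w @ [Zero]) \<in> pcong n" by simp
        from pres_cong.trans[OF this pres_cong_Zero(1)[OF w]] show ?thesis
          using sab Gen Cons False by (simp add: w_def)
      qed
    qed
  qed
qed

lemma pcong_nf_word: "w \<in> lists (polycyclic_letters n) \<Longrightarrow> (w, nf_word (nf w)) \<in> pcong n"
proof (induction w rule: rev_induct)
  case Nil
  then show ?case by (simp add: nf_def pres_cong.refl)
next
  case (snoc x w)
  then have "(w @ [x], nf_word (nf w) @ [x]) \<in> pcong n"
    by (intro pres_cong_append_right) auto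
  moreover have "(nf_word (nf w) @ [x], nf_word (nf_step (nf w) x)) \<in> pcong n"
    using snoc.prems by (intro pcong_nf_step valid_nf) auto
  ultimately show ?case by (auto simp: nf_def intro: pres_cong.trans)
qed

lemma elem_eq_iff:
  assumes "u \<in> lists (polycyclic_letters n)" "v \<in> lists (polycyclic_letters n)"
  shows "polycyclic_elem n u = polycyclic_elem n v \<longleftrightarrow> nf u = nf v"
proof -
  have "(u, v) \<in> pcong n" if "nf u = nf v"
    using pcong_nf_word[OF assms(1)] pcong_nf_word[OF assms(2)] that
    by (metis pres_cong.sym pres_cong.trans)
  then show ?thesis
    unfolding polycyclic_elem_def word_class_eq_iff[OF assms] using pcong_nf by blast
qed

definition nf_elem :: "nat \<Rightarrow> nform \<Rightarrow> letter list set" where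
  "nf_elem n s = polycyclic_elem n (nf_word s)"

lemma polycyclic_elem_eq_nf_elem:
  "w \<in> lists (polycyclic_letters n) \<Longrightarrow> polycyclic_elem n w = nf_elem n (nf w)"
  by (simp add: nf_elem_def elem_eq_iff nf_word_in_lists valid_nf)

lemma nf_elem_eq_iff: "valid n s \<Longrightarrow> valid n t \<Longrightarrow> nf_elem n s = nf_elem n t \<longleftrightarrow> s = t"
  by (simp add: nf_elem_def elem_eq_iff nf_word_in_lists)

lemma valid_nf_mult: "valid n s \<Longrightarrow> valid n t \<Longrightarrow> valid n (nf_mult s t)"
  using valid_nf[of "nf_word s @ nf_word t" n] by (simp add: nf_append nf_word_in_lists)

lemma nf_elem_mult:
  assumes "valid n s" "valid n t"
  shows "nf_elem n s \<otimes>\<^bsub>polycyclic_monoid n\<^esub> nf_elem n t = nf_elem n (nf_mult s t)"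
proof -
  note l = nf_word_in_lists[OF assms(1)] nf_word_in_lists[OF assms(2)]
  have "nf_elem n s \<otimes>\<^bsub>polycyclic_monoid n\<^esub> nf_elem n t = polycyclic_elem n (nf_word s @ nf_word t)"
    using mult_word_class[OF l] by (simp add: nf_elem_def polycyclic_elem_def polycyclic_monoid_def)
  also have "\<dots> = nf_elem n (nf_mult s t)"
    using l by (subst polycyclic_elem_eq_nf_elem) (auto simp: nf_append)
  finally show ?thesis .
qed

lemma carrier_polycyclic: "carrier (polycyclic_monoid n) = nf_elem n ` {s. valid n s}"
proof
  show "carrier (polycyclic_monoid n) \<subseteq> nf_elem n ` {s. valid n s}"
  proof
    fix A assume "A \<in> carrier (polycyclic_monoid n)"
    then obtain w where w: "w \<in> lists (polycyclic_letters n)" "A = polycyclic_elem n w"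
      unfolding polycyclic_monoid_def polycyclic_elem_def by (rule presented_monoid_carrierE)
    then show "A \<in> nf_elem n ` {s. valid n s}"
      using valid_nf[OF w(1)] by (auto simp: polycyclic_elem_eq_nf_elem)
  qed
  show "nf_elem n ` {s. valid n s} \<subseteq> carrier (polycyclic_monoid n)"
    by (auto simp: nf_elem_def polycyclic_elem_def polycyclic_monoid_def
        intro!: word_class_in_carrier nf_word_in_lists)
qed

lemma is_zero_nf_elem:
  assumes "valid n s"
  shows "is_zero (polycyclic_monoid n) (nf_elem n s) \<longleftrightarrow> s = None"
proof -
  have z: "is_zero (polycyclic_monoid n) (nf_elem n None)"
    using is_zero_polycyclic[of n] by (simp add: nf_elem_def)
  have "nf_elem n s = nf_elem n None" if "is_zero (polycyclic_monoid n) (nf_elem n s)"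
    using that z unfolding is_zero_def by metis
  then show ?thesis using z assms nf_elem_eq_iff[of n s None] by auto
qed

section \<open>Both conjugacy relations expressed through remainders\<close>

lemma p_conjugate_nf_elem:
  assumes "valid n s" "valid n t"
  shows "p_conjugate (polycyclic_monoid n) (nf_elem n s) (nf_elem n t) \<longleftrightarrow>
     (\<exists>u v. valid n u \<and> valid n v \<and> s = nf_mult u v \<and> t = nf_mult v u)"
proof -
  have "p_conjugate (polycyclic_monoid n) (nf_elem n s) (nf_elem n t) \<longleftrightarrow>
      (\<exists>u v. valid n u \<and> valid n v \<and> nf_elem n s = nf_elem n u \<otimes>\<^bsub>polycyclic_monoid n\<^esub> nf_elem n v
        \<and> nf_elem n t = nf_elem n v \<otimes>\<^bsub>polycyclic_monoid n\<^esub> nf_elem n u)"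
    by (auto simp: p_conjugate_def carrier_polycyclic)
  also have "\<dots> \<longleftrightarrow> (\<exists>u v. valid n u \<and> valid n v \<and> s = nf_mult u v \<and> t = nf_mult v u)"
    using assms by (intro ex_cong1 conj_cong refl) (simp_all add: nf_elem_mult nf_elem_eq_iff valid_nf_mult)
  finally show ?thesis .
qed

definition nf_conjugators :: "nat \<Rightarrow> nform \<Rightarrow> nform set" where
  "nf_conjugators n s = {g. valid n g \<and> (if s = None then g = None
      else \<forall>m. valid n m \<longrightarrow> nf_mult (nf_mult m s) g = None \<longrightarrow> nf_mult m s = None)}"

lemma conjugators_nf_elem:
  assumes "valid n s"
  shows "conjugators (polycyclic_monoid n) (nf_elem n s) = nf_elem n ` nf_conjugators n s"
proof -
  have ex: "\<exists>z. is_zero (polycyclic_monoid n) z" using is_zero_polycyclic by blast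
  show ?thesis
  proof (cases "s = None")
    case True
    then have "nf_conjugators n s = {None}" by (auto simp: nf_conjugators_def)
    then show ?thesis
      using True ex is_zero_nf_elem[OF assms] by (simp add: conjugators_def)
  next
    case False
    have "conjugators (polycyclic_monoid n) (nf_elem n s) =
        {g \<in> nf_elem n ` {s. valid n s}. \<forall>m\<in>nf_elem n ` {s. valid n s}.
              is_zero (polycyclic_monoid n) (m \<otimes>\<^bsub>polycyclic_monoid n\<^esub> nf_elem n s \<otimes>\<^bsub>polycyclic_monoid n\<^esub> g) \<longrightarrow>
              is_zero (polycyclic_monoid n) (m \<otimes>\<^bsub>polycyclic_monoid n\<^esub> nf_elem n s)}"
      using ex is_zero_nf_elem[OF assms] False unfolding conjugators_def carrier_polycyclic by simp
    also have "\<dots> = nf_elem n ` nf_conjugators n s"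
      using assms False
      by (auto simp: nf_conjugators_def nf_elem_mult valid_nf_mult is_zero_nf_elem)
    finally show ?thesis .
  qed
qed

lemma c_conjugate_nf_elem:
  assumes "valid n s" "valid n t"
  shows "c_conjugate (polycyclic_monoid n) (nf_elem n s) (nf_elem n t) \<longleftrightarrow>
     (\<exists>g\<in>nf_conjugators n s. \<exists>h\<in>nf_conjugators n t. nf_mult s g = nf_mult g t \<and> nf_mult t h = nf_mult h s)"
proof -
  have v: "valid n g" if "g \<in> nf_conjugators n s" for g s using that by (simp add: nf_conjugators_def)
  show ?thesis
    using assms v
    by (auto simp: c_conjugate_def conjugators_nf_elem nf_elem_mult nf_elem_eq_iff valid_nf_mult)
qed

definition p_test :: "nform \<Rightarrow> nform \<Rightarrow> bool" where
  "p_test s t = (case (s, t) of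
      (None, None) \<Rightarrow> True
    | (None, Some (c, d)) \<Rightarrow> fst (strip c d) \<noteq> [] \<and> snd (strip c d) \<noteq> []
    | (Some (a, b), None) \<Rightarrow> fst (strip a b) \<noteq> [] \<and> snd (strip a b) \<noteq> []
    | (Some (a, b), Some (c, d)) \<Rightarrow> strip a b = strip c d
        \<or> snd (strip a b) = [] \<and> snd (strip c d) = [] \<and> cyclic (fst (strip a b)) (fst (strip c d))
        \<or> fst (strip a b) = [] \<and> fst (strip c d) = [] \<and> cyclic (snd (strip a b)) (snd (strip c d)))"

definition c_test :: "nform \<Rightarrow> nform \<Rightarrow> bool" where
  "c_test s t = (case (s, t) of
      (None, None) \<Rightarrow> True
    | (Some (a, b), Some (c, d)) \<Rightarrow> strip a b = strip c d
        \<or> fst (strip a b) = [] \<and> fst (strip c d) = [] \<and> cyclic (snd (strip a b)) (snd (strip c d))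
    | _ \<Rightarrow> False)"

lemma c_test_sym: "c_test s t = c_test t s"
  by (auto simp: c_test_def cyclic_sym split: option.splits)

text \<open>The prefixes \<open>e\<close> and \<open>e'\<close> removed at the two junctions of
  \<open>u\<close> and \<open>v\<close> are common prefixes within the products too, so they do not
  affect the remainders. If both products are nonzero, the remainders coincide or are
  \<open>q' @ q\<close> against \<open>q @ q'\<close>, or \<open>p' @ p\<close> against
  \<open>p @ p'\<close>. If one vanishes, say because \<open>p\<close> and \<open>q\<close> are
  nonempty, the other is zero or has two nonempty remainders, as \<open>hd p\<close> and
  \<open>hd q\<close> differ.\<close>

lemma p_test_nf_mult: "p_test (nf_mult u v) (nf_mult v u)"
proof (cases "u = None \<or> v = None")
  case True
  then show ?thesis by (auto simp: p_test_def)
next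
  case False
  then obtain u1 u2 v1 v2 where uv: "u = Some (u1, u2)" "v = Some (v1, v2)" by auto
  obtain e p q where 1: "u2 = e @ p" "v1 = e @ q" "strip u2 v1 = (p, q)" "p = [] \<or> q = [] \<or> hd p \<noteq> hd q"
    by (rule stripE)
  obtain e' p' q' where 2: "v2 = e' @ p'" "u1 = e' @ q'" "strip v2 u1 = (p', q')"
    "p' = [] \<or> q' = [] \<or> hd p' \<noteq> hd q'"
    by (rule stripE)
  have s: "strip p q = (p, q)" "strip q p = (q, p)" "strip p' q' = (p', q')" "strip q' p' = (q', p')"
    using 1(4) 2(4) by (auto simp: strip_eq)
  show ?thesis
    using 1(3,4) 2(3,4) s cyclicI[of q' q] cyclicI[of p p'] cyclicI[of p' p] unfolding uv 1(1,2) 2(1,2)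
    by (cases p; cases q; cases p'; cases q') (auto simp: p_test_def)
qed

lemma p_testD:
  assumes "valid n s" "valid n t" "p_test s t"
  shows "\<exists>u v. valid n u \<and> valid n v \<and> s = nf_mult u v \<and> t = nf_mult v u"
proof -
  \<comment> \<open>The factors are \<open>d^-1\<close> and \<open>c\<close>: their product
    \<open>d^-1 c\<close> is zero because the remainders of \<open>c\<close> and \<open>d\<close>
    are both nonempty, and \<open>c d^-1\<close> is the given element.\<close>
  have zero: "\<exists>u v. valid n u \<and> valid n v \<and> None = nf_mult u v \<and> Some (c, d) = nf_mult v u"
    if "valid n (Some (c, d))" "fst (strip c d) \<noteq> []" "snd (strip c d) \<noteq> []" for c d
  proof -
    have "strip d c = prod.swap (strip c d)" by (induction c d rule: strip.induct) auto
    then show ?thesis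
      using that by (intro exI[of _ "Some ([], d)"] exI[of _ "Some (c, [])"]) (auto split: prod.splits)
  qed
  consider "s = None" "t = None" | c d where "s = None" "t = Some (c, d)"
    | a b where "s = Some (a, b)" "t = None"
    | a b c d where "s = Some (a, b)" "t = Some (c, d)" by (cases s; cases t) auto
  then show ?thesis
  proof cases
    case 1
    then show ?thesis by (intro exI[of _ None]) simp
  next
    case 2
    then show ?thesis using assms zero[of c d] by (simp add: p_test_def)
  next
    case 3
    then show ?thesis using assms zero[of a b] by (simp add: p_test_def) blast
  next
    case 4
    obtain e p q where 5: "a = e @ p" "b = e @ q" "strip a b = (p, q)" by (rule stripE)
    obtain e' p' q' where 6: "c = e' @ p'" "d = e' @ q'" "strip c d = (p', q')" by (rule stripE)
    have v: "set e \<subseteq> {1..n}" "set p \<subseteq> {1..n}" "set q \<subseteq> {1..n}" "set e' \<subseteq> {1..n}"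
      "set p' \<subseteq> {1..n}" "set q' \<subseteq> {1..n}"
      using assms 4 5(1,2) 6(1,2) by auto
    from assms(3) consider "p = p'" "q = q'" | x y where "q = []" "q' = []" "p = x @ y" "p' = y @ x"
      | x y where "p = []" "p' = []" "q = x @ y" "q' = y @ x"
      by (auto simp: p_test_def 4 5(3) 6(3) cyclic_def)
    \<comment> \<open>In each case \<open>u\<close> has the shape \<open>e ... e'^-1\<close> and
      \<open>v\<close> the shape \<open>e' ... e^-1\<close>, so the inner prefixes cancel in both
      products. The remainders go into \<open>v\<close> entirely, or are shared out between
      \<open>u\<close> and \<open>v\<close> along the splitting into \<open>x\<close> and
      \<open>y\<close>.\<close>
    then show ?thesis
    proof cases
      case 1
      then show ?thesis using v unfolding 4 5(1,2) 6(1,2)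
        by (intro exI[of _ "Some (e, e')"] exI[of _ "Some (e' @ p, e @ q)"]) auto
    next
      case 2
      then show ?thesis using v unfolding 4 5(1,2) 6(1,2)
        by (intro exI[of _ "Some (e @ x, e')"] exI[of _ "Some (e' @ y, e)"]) auto
    next
      case 3
      then show ?thesis using v unfolding 4 5(1,2) 6(1,2)
        by (intro exI[of _ "Some (e, e' @ y)"] exI[of _ "Some (e', e @ x)"]) auto
    qed
  qed
qed

lemma p_conjugate_iff_test:
  "valid n s \<Longrightarrow> valid n t \<Longrightarrow>
    p_conjugate (polycyclic_monoid n) (nf_elem n s) (nf_elem n t) \<longleftrightarrow> p_test s t"
  using p_testD p_test_nf_mult by (auto simp: p_conjugate_nf_elem)

text \<open>A nonzero \<open>m a b^-1\<close> has an inverse part starting with \<open>b\<close>, so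
  a \<open>g1\<close> that is a prefix of \<open>b\<close> is always absorbed. A \<open>g1\<close>
  that deviates from \<open>b\<close> or goes beyond it is blocked by a suitable \<open>m\<close>;
  in the second case this takes a second generator.\<close>

lemma nf_conjugators_Some:
  assumes "n \<ge> 2" "valid n (Some (a, b))"
  shows "g \<in> nf_conjugators n (Some (a, b)) \<longleftrightarrow>
    valid n g \<and> (\<exists>g1 g2 s. g = Some (g1, g2) \<and> b = g1 @ s)"
proof
  assume g: "g \<in> nf_conjugators n (Some (a, b))"
  then have vg: "valid n g"
    and m: "\<And>m. valid n m \<Longrightarrow> nf_mult (nf_mult m (Some (a, b))) g = None \<Longrightarrow> nf_mult m (Some (a, b)) = None"
    by (auto simp: nf_conjugators_def)
  from m[of "Some ([], [])"] have "g \<noteq> None" by (cases g) auto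
  then obtain g1 g2 where gg: "g = Some (g1, g2)" by auto
  obtain e p q where 1: "b = e @ p" "g1 = e @ q" "strip b g1 = (p, q)" "p = [] \<or> q = [] \<or> hd p \<noteq> hd q"
    by (rule stripE)
  have "q = []"
  proof (rule ccontr)
    assume q: "q \<noteq> []"
    \<comment> \<open>With a letter \<open>j\<close> other than the next one of \<open>g1\<close>, the element \<open>m = (a j)\<^sup>-\<^sup>1\<close> has
      \<open>m a g = 0\<close> but \<open>m a \<noteq> 0\<close>.\<close>
    define j :: nat where "j = (if hd q = 1 then 2 else 1)"
    have j: "j \<in> {1..n}" "j \<noteq> hd q" using assms(1) by (auto simp: j_def)
    have "nf_mult (Some ([], a @ [j])) (Some (a, b)) = Some ([], b @ [j])" by simp
    moreover have "strip (b @ [j]) g1 = strip (p @ [j]) q" by (simp add: 1(1,2))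
    moreover have "strip (p @ [j]) q = (p @ [j], q)"
      using q j 1(4) by (intro strip_eq) (auto simp: hd_append)
    ultimately show False
      using m[of "Some ([], a @ [j])"] assms(2) j(1) q by (simp add: gg)
  qed
  then show "valid n g \<and> (\<exists>g1 g2 s. g = Some (g1, g2) \<and> b = g1 @ s)"
    using vg 1 gg by auto
next
  assume "valid n g \<and> (\<exists>g1 g2 s. g = Some (g1, g2) \<and> b = g1 @ s)"
  then obtain g1 g2 s where g: "valid n g" "g = Some (g1, g2)" "b = g1 @ s" by auto
  have "nf_mult m (Some (a, b)) = None"
    if vm: "valid n m" and z: "nf_mult (nf_mult m (Some (a, b))) g = None" for m
  proof (rule ccontr)
    assume "nf_mult m (Some (a, b)) \<noteq> None"
    then obtain c d where "nf_mult m (Some (a, b)) = Some (c, g1 @ d)"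
      by (cases m) (auto simp: g(3) split: prod.splits if_splits)
    then show False using z by (simp add: g(2) split: if_splits)
  qed
  then show "g \<in> nf_conjugators n (Some (a, b))" using g by (auto simp: nf_conjugators_def)
qed

text \<open>With \<open>b = g1 @ s\<close> the left product is \<open>a (g2 s)^-1\<close>. If
  \<open>g2\<close> is a prefix of \<open>c\<close>, comparison gives \<open>a = g1 @ q\<close> and
  \<open>d = g2 @ s\<close>, so both remainders are those of \<open>q\<close> and \<open>s\<close>.
  Otherwise \<open>a = g1\<close> and \<open>c = e\<close>, so both positive remainders are empty,
  and the equation \<open>p @ s = r @ p\<close> is left for the inverse ones.\<close>

lemma c_test_sound:
  assumes "n \<ge> 2" "valid n (Some (a, b))" "valid n (Some (c, d))"
    and "g \<in> nf_conjugators n (Some (a, b))" "nf_mult (Some (a, b)) g = nf_mult g (Some (c, d))"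
  shows "c_test (Some (a, b)) (Some (c, d))"
proof -
  obtain g1 g2 s where g: "g = Some (g1, g2)" "b = g1 @ s"
    using assms(4) unfolding nf_conjugators_Some[OF assms(1,2)] by auto
  obtain e p q where 1: "g2 = e @ p" "c = e @ q" "strip g2 c = (p, q)" by (rule stripE)
  have eq: "Some (a, g2 @ s) =
    (if p = [] then Some (g1 @ q, d) else if q = [] then Some (g1, d @ p) else None)"
    using assms(5) 1(3) by (cases s) (simp_all add: g)
  show ?thesis
  proof (cases "p = []")
    case True
    then show ?thesis using eq by (auto simp: c_test_def g 1)
  next
    case False
    then have "a = g1" "e @ p @ s = d @ p" "q = []" using eq 1 by (auto split: if_splits)
    moreover obtain r where "d = e @ r" "p @ s = r @ p"
    proof -
      have "length e \<le> length d"
        using arg_cong[OF \<open>e @ p @ s = d @ p\<close>, of length] by simp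
      then have "e = take (length e) d"
        using arg_cong[OF \<open>e @ p @ s = d @ p\<close>, of "take (length e)"] by simp
      then obtain r where "d = e @ r" by (metis append_take_drop_id)
      then show ?thesis using that \<open>e @ p @ s = d @ p\<close> by simp
    qed
    ultimately show ?thesis
      using intertwined_cyclic[of p s r] by (simp add: c_test_def g 1)
  qed
qed

text \<open>The witness is the factor \<open>u\<close> from \<open>p_testD\<close>; its positive
  part \<open>e\<close> is a prefix of \<open>b\<close>. In the case dropped from
  \<open>c_test\<close> that part would be \<open>e @ x\<close> while \<open>b = e\<close>.\<close>

lemma c_testD:
  assumes "n \<ge> 2" "valid n (Some (a, b))" "valid n (Some (c, d))" "c_test (Some (a, b)) (Some (c, d))"
  shows "\<exists>g\<in>nf_conjugators n (Some (a, b)). nf_mult (Some (a, b)) g = nf_mult g (Some (c, d))"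
proof -
  obtain e p q where 5: "a = e @ p" "b = e @ q" "strip a b = (p, q)" by (rule stripE)
  obtain e' p' q' where 6: "c = e' @ p'" "d = e' @ q'" "strip c d = (p', q')" by (rule stripE)
  have v: "set e \<subseteq> {1..n}" "set p \<subseteq> {1..n}" "set q \<subseteq> {1..n}" "set e' \<subseteq> {1..n}"
      "set p' \<subseteq> {1..n}" "set q' \<subseteq> {1..n}"
    using assms 5(1,2) 6(1,2) by auto
  from assms(4) consider "p = p'" "q = q'" | x y where "p = []" "p' = []" "q = x @ y" "q' = y @ x"
    by (auto simp: c_test_def 5(3) 6(3) cyclic_def)
  then show ?thesis
  proof cases
    case 1
    have "Some (e, e') \<in> nf_conjugators n (Some (a, b))"
      unfolding nf_conjugators_Some[OF assms(1,2)] using v 5 by simp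
    then show ?thesis using 1 by (intro bexI[of _ "Some (e, e')"]) (auto simp: 5 6)
  next
    case 2
    have "Some (e, e' @ y) \<in> nf_conjugators n (Some (a, b))"
      unfolding nf_conjugators_Some[OF assms(1,2)] using v 2 5 by simp
    then show ?thesis using 2 by (intro bexI[of _ "Some (e, e' @ y)"]) (auto simp: 5 6)
  qed
qed

lemma c_conjugate_iff_test:
  assumes "n \<ge> 2" "valid n s" "valid n t"
  shows "c_conjugate (polycyclic_monoid n) (nf_elem n s) (nf_elem n t) \<longleftrightarrow> c_test s t"
proof -
  have None: "nf_conjugators n None = {None}" by (auto simp: nf_conjugators_def)
  \<comment> \<open>Taking \<open>m = 1\<close>: a conjugator never annihilates its own element. As
    only zero is a conjugator of zero, zero is related to nothing else.\<close>
  have one: "g \<in> nf_conjugators n (Some ab) \<Longrightarrow> nf_mult (Some ab) g \<noteq> None" for g ab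
    by (auto simp: nf_conjugators_def dest!: spec[of _ "Some ([], [])"])
  consider "s = None" "t = None" | cd where "s = None" "t = Some cd"
    | ab where "s = Some ab" "t = None"
    | a b c d where "s = Some (a, b)" "t = Some (c, d)" by (cases s; cases t) auto
  then show ?thesis
  proof cases
    case 4
    note v = assms(2,3)[unfolded 4]
    show ?thesis
      unfolding 4 c_conjugate_nf_elem[OF v]
      using c_test_sound[OF assms(1) v] c_testD[OF assms(1) v] c_testD[OF assms(1) v(2,1)]
        c_test_sym by blast
  qed (use one assms in \<open>auto simp: c_conjugate_nf_elem None c_test_def\<close>)
qed

section \<open>Rotations of words\<close>

lemma cyclic_iff_rotate: "cyclic xs ys \<longleftrightarrow> (\<exists>m. ys = rotate m xs)"
proof
  assume "cyclic xs ys"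
  then show "\<exists>m. ys = rotate m xs" by (metis cyclic_def rotate_append)
next
  assume "\<exists>m. ys = rotate m xs"
  then show "cyclic xs ys"
    unfolding cyclic_def rotate_drop_take by (metis append_take_drop_id)
qed

lemma cyclic_trans: "cyclic xs ys \<Longrightarrow> cyclic ys zs \<Longrightarrow> cyclic xs zs"
  unfolding cyclic_iff_rotate by (metis rotate_rotate)

lemma nth_double: "p < 2 * length w \<Longrightarrow> (w @ w) ! p = w ! (p mod length w)"
  by (auto simp: nth_append le_mod_geq not_less)

lemma nth_double_rotate:
  "i + p < 2 * length w \<Longrightarrow> p < length w \<Longrightarrow> (w @ w) ! (i + p) = rotate i w ! p"
  by (simp only: nth_double nth_rotate)

lemma lexI_nth:
  assumes "length xs = length ys" "m < length xs" "\<And>p. p < m \<Longrightarrow> xs ! p = ys ! p" "xs ! m < ys ! m"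
  shows "(xs, ys) \<in> lex less_than"
proof -
  have "take m xs = take m ys"
    using assms by (intro nth_equalityI) auto
  moreover have "xs = take m xs @ xs ! m # drop (Suc m) xs" "ys = take m ys @ ys ! m # drop (Suc m) ys"
    using assms(1,2) by (simp_all add: id_take_nth_drop[symmetric])
  ultimately show ?thesis
    unfolding lex_conv using assms(1,4) by force
qed

definition beaten :: "nat list \<Rightarrow> nat list \<Rightarrow> nat \<Rightarrow> bool" where
  "beaten v w i \<longleftrightarrow> (\<forall>t<i. \<exists>s. (rotate s v, rotate t w) \<in> lex less_than)"

lemma beaten_0 [simp]: "beaten v w 0"
  by (simp add: beaten_def)

text \<open>Shifting both starting points by the same \<open>d\<close> keeps the mismatch, now after
  \<open>k - d\<close> equal letters, so the rotation of \<open>v\<close> from \<open>j + d\<close>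
  is smaller than that of \<open>w\<close> from \<open>i + d\<close>. The bound
  \<open>k < length w\<close> keeps the mismatch within one turn.\<close>

lemma beaten_step:
  assumes len: "length v = length w" and k: "k < length w"
    and b: "beaten v w i" and ij: "i + k < 2 * length w" "j + k < 2 * length w"
    and eq: "\<And>t. t < k \<Longrightarrow> (w @ w) ! (i + t) = (v @ v) ! (j + t)"
    and less: "(v @ v) ! (j + k) < (w @ w) ! (i + k)"
  shows "beaten v w (i + k + 1)"
  unfolding beaten_def
proof (intro allI impI)
  fix t assume t: "t < i + k + 1"
  show "\<exists>s. (rotate s v, rotate t w) \<in> lex less_than"
  proof (cases "t < i")
    case True
    then show ?thesis using b by (simp add: beaten_def)
  next
    case False
    define d where "d = t - i"
    have d: "t = i + d" "d \<le> k" using False t by (auto simp: d_def)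
    have vw: "rotate (j + d) v ! p = (v @ v) ! (j + (d + p))" "rotate (i + d) w ! p = (w @ w) ! (i + (d + p))"
      if "p \<le> k - d" for p
      using nth_double_rotate[of "j + d" p v] nth_double_rotate[of "i + d" p w] that d k ij len
      by (simp_all add: add.assoc)
    have "(rotate (j + d) v, rotate (i + d) w) \<in> lex less_than"
    proof (rule lexI_nth[of _ _ "k - d"])
      show "rotate (j + d) v ! p = rotate (i + d) w ! p" if "p < k - d" for p
        using vw[of p] eq[of "d + p"] that by simp
      show "rotate (j + d) v ! (k - d) < rotate (i + d) w ! (k - d)"
        using vw[of "k - d"] less d by simp
    qed (use len k in auto)
    then show ?thesis using d by auto
  qed
qed

text \<open>If \<open>w\<close> and \<open>v\<close> were conjugate, the least rotation of
  \<open>v\<close> would be a rotation of \<open>w\<close> starting below \<open>length w\<close>,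
  hence would exceed some rotation of \<open>v\<close>.\<close>

lemma beaten_not_cyclic:
  assumes "beaten v w i" "length w \<le> i" "w \<noteq> []"
  shows "\<not> cyclic w v"
proof
  assume "cyclic w v"
  have "rotate 0 v \<in> range (\<lambda>s. rotate s v)" by blast
  then obtain r where r: "r \<in> range (\<lambda>s. rotate s v)"
    and min: "\<And>y. (y, r) \<in> lex less_than \<Longrightarrow> y \<notin> range (\<lambda>s. rotate s v)"
    using wfE_min[OF wf_lex[OF wf_less_than]] by metis
  have "cyclic w r"
    using r \<open>cyclic w v\<close> cyclic_trans cyclic_iff_rotate by blast
  then obtain m where "r = rotate m w" by (auto simp: cyclic_iff_rotate)
  then have "r = rotate (m mod length w) w" by (simp add: rotate_conv_mod[symmetric])
  moreover have "m mod length w < i" using assms(2,3) by (metis length_greater_0_conv mod_less_divisor order_less_le_trans)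
  ultimately show False using assms(1) min by (force simp: beaten_def)
qed

lemma matched_cyclic:
  assumes len: "length v = length w" and ij: "i \<le> length w" "j \<le> length w"
    and eq: "\<And>t. t < length w \<Longrightarrow> (w @ w) ! (i + t) = (v @ v) ! (j + t)"
  shows "cyclic w v"
proof -
  have "rotate i w = rotate j v"
  proof (rule nth_equalityI)
    fix t assume "t < length (rotate i w)"
    then show "rotate i w ! t = rotate j v ! t"
      using eq[of t] nth_double_rotate[of i t w] nth_double_rotate[of j t v] len ij by simp
  qed (simp add: len)
  then show ?thesis using cyclic_trans cyclic_sym cyclic_iff_rotate by metis
qed

section \<open>Computing the remainders\<close>

text \<open>With \<open>t - 1\<close> instead of \<open>Suc t\<close> the simplifier can run programs under time bounds that
  contain numerals.\<close>

lemma halts_step: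
  assumes "0 < t"
  shows "halts (Op i f m # k) Z b t \<longleftrightarrow> halts k (Z(i := ztape_act (f (scan Z)) m (Z i))) b (t - 1)"
    and "halts (Seq p q # k) Z b t \<longleftrightarrow> halts (p # q # k) Z b (t - 1)"
    and "halts (Cond c p q # k) Z b t \<longleftrightarrow>
       (if c (scan Z) then halts (p # k) Z b (t - 1) else halts (q # k) Z b (t - 1))"
    and "halts (Done b' # k) Z b t \<longleftrightarrow> b' = b"
  using assms by (cases t; simp add: halts_simps)+

lemma halts_cong: "halts k Z b t \<Longrightarrow> Z' = Z \<Longrightarrow> t \<le> t' \<Longrightarrow> halts k Z' b t'"
  using halts_mono by blast

lemma halts_While_step:
  "0 < t \<Longrightarrow> halts (While c p # k) Z b t \<longleftrightarrow>
    (if c (scan Z) then halts (p # While c p # k) Z b (t - 1) else halts k Z b (t - 1))"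
  by (cases t; simp add: halts_simps)

type_synonym ltapes = "nat \<Rightarrow> letter ztape"

abbreviation gens :: "nat list \<Rightarrow> letter tape_symbol list" where
  "gens w \<equiv> map (\<lambda>j. Input (Gen j)) w"

lemma bcons_simps [simp]:
  "bcons Blank [] = []" "x \<noteq> Blank \<Longrightarrow> bcons x xs = x # xs" "bcons x (y # ys) = x # y # ys"
  by (auto simp: bcons_def)

lemma bhd_simps [simp]: "bhd [] = Blank" "bhd (x # xs) = x" "bhd (bcons x xs) = x"
  by (auto simp: bhd_def bcons_def)

lemma bcons_bhd_tl [simp]: "Blank \<notin> set xs \<Longrightarrow> bcons (bhd xs) (tl xs) = xs"
  by (cases xs) auto

lemma bhd_append [simp]: "bhd (xs @ ys) = (if xs = [] then bhd ys else bhd xs)"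
  by (cases xs) auto

lemma bhd_gens_eq [simp]: "bhd (gens w) = Blank \<longleftrightarrow> w = []" "Blank = bhd (gens w) \<longleftrightarrow> w = []"
  by (cases w; simp)+

abbreviation keep :: "nat \<Rightarrow> move \<Rightarrow> letter prog" where
  "keep i m \<equiv> Op i (\<lambda>rd. rd i) m"

definition rewind_loop :: "nat \<Rightarrow> letter prog" where
  "rewind_loop i = While (\<lambda>rd. rd i \<noteq> Blank) (keep i Move_Left)"

text \<open>The head may stand on the blank behind the word, where the loop would stop at once;
  hence the initial move to the left.\<close>

definition rewind :: "nat \<Rightarrow> letter prog" where
  "rewind i = Seq (keep i Move_Left) (Seq (rewind_loop i) (keep i Move_Right))"

lemma halts_rewind_loop:
  assumes "Z i = (u, x # v)" "Blank \<notin> set u" "x \<noteq> Blank"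
    "halts k (Z(i := ([], Blank # rev u @ x # v))) b t"
  shows "halts (rewind_loop i # k) Z b (t + 2 * length u + 3)"
  using assms
proof (induction u arbitrary: Z x v)
  case Nil
  then show ?case
    unfolding rewind_loop_def
    by (auto simp: halts_While_step halts_step scan_def intro!: halts_cong[OF Nil(4)])
next
  case (Cons y u)
  have "halts (rewind_loop i # k) (Z(i := (u, y # x # v))) b (t + 2 * length u + 3)"
  proof (rule Cons.IH[where x = y and v = "x # v"])
    show "halts k ((Z(i := (u, y # x # v)))(i := ([], Blank # rev u @ y # x # v))) b t"
      by (rule halts_cong[OF Cons.prems(4)]) auto
  qed (use Cons.prems in auto)
  then show ?case
    using Cons.prems unfolding rewind_loop_def
    by (subst halts_While_step) (auto simp: halts_step scan_def elim!: halts_mono)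
qed

lemma halts_rewind:
  assumes "Z i = (u, v)" "Blank \<notin> set u" "Blank \<notin> set v"
    "halts k (Z(i := ([], rev u @ v))) b t"
  shows "halts (rewind i # k) Z b (t + 2 * length u + 10)"
proof (cases u)
  case Nil
  then show ?thesis
    using assms unfolding rewind_def rewind_loop_def
    by (cases v) (auto simp: halts_step halts_While_step scan_def elim!: halts_mono)
next
  case (Cons y u')
  have "bcons y v = y # v" using Cons assms by auto
  moreover have "halts (rewind_loop i # keep i Move_Right # k) (Z(i := (u', y # v))) b (t + 1 + 2 * length u' + 3)"
    using Cons assms by (intro halts_rewind_loop) (auto simp: halts_step scan_def)
  ultimately show ?thesis
    using assms Cons unfolding rewind_def
    by (auto simp: halts_step scan_def elim!: halts_mono)
qed

definition is_input :: "letter tape_symbol \<Rightarrow> bool" where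
  "is_input s \<longleftrightarrow> s \<in> range Input"

lemma is_input_simps [simp]: "is_input (Input x)" "\<not> is_input Blank" "\<not> is_input Separator"
  by (auto simp: is_input_def)

text \<open>Inverse letters are stacked as generators, so that cancellation is tested by equality of
  symbols. \<open>uninvert s \<noteq> s\<close> also serves as the test for an inverse
  letter.\<close>

fun uninvert :: "letter tape_symbol \<Rightarrow> letter tape_symbol" where
  "uninvert (Input (Inv j)) = Input (Gen j)"
| "uninvert s = s"

definition mark :: "nat \<Rightarrow> letter prog" where
  "mark z = Op z (\<lambda>_. Separator) Stay"

text \<open>The head of \<open>b\<close> rests on the blank above the stack and must step left to
  see the top. Erasing the top in place restores this position; after a mismatch only the flag on
  \<open>z\<close> matters.\<close>

definition parse_letter :: "nat \<Rightarrow> nat \<Rightarrow> nat \<Rightarrow> letter prog" where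
  "parse_letter z a b = Seq
     (Cond (\<lambda>rd. rd z = Separator) (keep z Stay)
       (Cond (\<lambda>rd. rd 0 = Input Zero) (mark z)
         (Cond (\<lambda>rd. uninvert (rd 0) \<noteq> rd 0) (Op b (\<lambda>rd. uninvert (rd 0)) Move_Right)
           (Seq (keep b Move_Left)
             (Cond (\<lambda>rd. rd b = Blank)
               (Seq (keep b Move_Right) (Op a (\<lambda>rd. rd 0) Move_Right))
               (Cond (\<lambda>rd. rd b = rd 0) (Op b (\<lambda>_. Blank) Stay) (mark z)))))))
     (keep 0 Move_Right)"

definition parse :: "nat \<Rightarrow> nat \<Rightarrow> nat \<Rightarrow> letter prog" where
  "parse z a b = While (\<lambda>rd. is_input (rd 0)) (parse_letter z a b)"

text \<open>Tape \<open>b\<close> has the first letter of \<open>\<beta>\<close> on top, since that letter is cancelled first; tape \<open>a\<close>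
  only ever grows.\<close>

definition parsed :: "nat \<Rightarrow> nat \<Rightarrow> nat \<Rightarrow> ltapes \<Rightarrow> nform \<Rightarrow> bool" where
  "parsed z a b Z s \<longleftrightarrow> (case s of None \<Rightarrow> Z z = ([], [Separator])
     | Some (\<alpha>, \<beta>) \<Rightarrow> Z z = ([], []) \<and> Z a = (rev (gens \<alpha>), []) \<and> Z b = (gens \<beta>, []))"

lemma halts_parse_letter:
  assumes "distinct [0, z, a, b]" "parsed z a b Z s" "Z 0 = (l, Input x # r)"
    and "\<And>Z'. Z' 0 = (Input x # l, r) \<Longrightarrow> parsed z a b Z' (nf_step s x) \<Longrightarrow>
      \<forall>i. i \<notin> {0, z, a, b} \<longrightarrow> Z' i = Z i \<Longrightarrow> halts k Z' bb t"
  shows "halts (parse_letter z a b # k) Z bb (t + 12)"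
proof -
  note I = assms(4)[THEN halts_mono]
  show ?thesis
  proof (cases s)
    case None
    then show ?thesis using assms(1-3) unfolding parse_letter_def
      by (auto simp: halts_step scan_def parsed_def intro!: I)
  next
    case (Some \<alpha>\<beta>)
    obtain \<alpha> \<beta> where s: "s = Some (\<alpha>, \<beta>)" using Some by (cases \<alpha>\<beta>) auto
    show ?thesis
    proof (cases x)
      case (Gen j)
      then show ?thesis using assms(1-3) unfolding parse_letter_def s
        by (cases \<beta>) (auto simp: s halts_step scan_def parsed_def mark_def intro!: I split: if_splits)
    next
      case (Inv j)
      then show ?thesis using assms(1-3) unfolding parse_letter_def s
        by (auto simp: s halts_step scan_def parsed_def intro!: I split: if_splits)
    next
      case Zero
      then show ?thesis using assms(1-3) unfolding parse_letter_def s
        by (auto simp: s halts_step scan_def parsed_def mark_def intro!: I split: if_splits)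
    qed
  qed
qed

text \<open>Each letter costs 12 steps and one loop test; the last test adds 1.\<close>

lemma halts_parse:
  assumes "distinct [0, z, a, b]" "parsed z a b Z s" "Z 0 = (l, map Input w @ r)" "\<not> is_input (bhd r)"
    and "\<And>Z'. Z' 0 = (rev (map Input w) @ l, r) \<Longrightarrow> parsed z a b Z' (foldl nf_step s w) \<Longrightarrow>
      \<forall>i. i \<notin> {0, z, a, b} \<longrightarrow> Z' i = Z i \<Longrightarrow> halts k Z' bb t"
  shows "halts (parse z a b # k) Z bb (t + 13 * length w + 1)"
  using assms(2-)
proof (induction w arbitrary: Z s l)
  case Nil
  have "halts k Z bb t" using Nil by auto
  then show ?case
    using Nil by (auto simp: parse_def halts_While_step scan_def)
next
  case (Cons x w)
  have *: "halts (parse_letter z a b # parse z a b # k) Z bb (t + 13 * length w + 1 + 12)"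
  proof (rule halts_parse_letter[OF assms(1) Cons.prems(1)])
    show "Z 0 = (l, Input x # map Input w @ r)" using Cons.prems by simp
    fix Z' assume Z': "Z' 0 = (Input x # l, map Input w @ r)" "parsed z a b Z' (nf_step s x)"
      "\<forall>i. i \<notin> {0, z, a, b} \<longrightarrow> Z' i = Z i"
    show "halts (parse z a b # k) Z' bb (t + 13 * length w + 1)"
    proof (rule Cons.IH[OF Z'(2,1) Cons.prems(3)])
      fix Z'' assume "Z'' 0 = (rev (map Input w) @ Input x # l, r)"
        "parsed z a b Z'' (foldl nf_step (nf_step s x) w)" "\<forall>i. i \<notin> {0, z, a, b} \<longrightarrow> Z'' i = Z' i"
      then show "halts k Z'' bb t" using Z'(3) by (intro Cons.prems(4)) auto
    qed
  qed
  show ?case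
    unfolding parse_def using * Cons.prems(2)
    by (subst halts_While_step) (auto simp: parse_def scan_def elim!: halts_mono)
qed

definition strip_loop :: "nat \<Rightarrow> nat \<Rightarrow> letter prog" where
  "strip_loop a b = While (\<lambda>rd. rd a \<noteq> Blank \<and> rd a = rd b)
     (Seq (Op a (\<lambda>_. Blank) Move_Right) (Op b (\<lambda>_. Blank) Move_Left))"

text \<open>The first letter is on top of the stack, so popping onto \<open>d\<close> lays the word
  out from left to right.\<close>

definition move_loop :: "nat \<Rightarrow> nat \<Rightarrow> letter prog" where
  "move_loop b d = While (\<lambda>rd. rd b \<noteq> Blank)
     (Seq (Op d (\<lambda>rd. rd b) Move_Right) (Op b (\<lambda>_. Blank) Move_Left))"

text \<open>A stack whose head has been moved from the blank above it onto the top element.\<close>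

definition stack_view :: "nat list \<Rightarrow> letter ztape" where
  "stack_view w = (tl (gens w), bcons (bhd (gens w)) [])"

lemma halts_strip_loop:
  assumes "a \<noteq> b" "Z a = ([], gens \<alpha>)" "Z b = stack_view \<beta>"
    and "halts k (Z(a := ([], gens (fst (strip \<alpha> \<beta>))), b := stack_view (snd (strip \<alpha> \<beta>)))) bb t"
  shows "halts (strip_loop a b # k) Z bb (t + 4 * length \<alpha> + 1)"
  using assms(2-)
proof (induction \<alpha> \<beta> arbitrary: Z rule: strip.induct)
  case (1 x xs y ys)
  show ?case
  proof (cases "x = y")
    case True
    have "halts (strip_loop a b # k) (Z(a := ([], gens xs), b := stack_view ys)) bb
        (t + 4 * length xs + 1)"
    proof (rule 1(1)[OF True])
      show "halts k ((Z(a := ([], gens xs), b := stack_view ys))(a := ([], gens (fst (strip xs ys))),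
          b := stack_view (snd (strip xs ys)))) bb t"
        by (rule halts_cong[OF 1(4)]) (use True assms(1) in \<open>auto simp: fun_eq_iff\<close>)
    qed (use assms(1) in auto)
    then show ?thesis
      using True 1(2,3) assms(1) unfolding strip_loop_def
      by (subst halts_While_step) (auto simp: halts_step scan_def stack_view_def elim!: halts_mono)
  next
    case False
    then have "halts k Z bb t" using 1(2-4) by (simp add: fun_upd_idem)
    then show ?thesis
      using False 1(2,3) assms(1) unfolding strip_loop_def
      by (subst halts_While_step) (auto simp: halts_step scan_def stack_view_def elim!: halts_mono)
  qed
next
  case ("2_1" ys)
  then have "halts k Z bb t" by (simp add: fun_upd_idem)
  then show ?case using "2_1" unfolding strip_loop_def
    by (subst halts_While_step) (auto simp: scan_def)
next
  case ("2_2" xs)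
  then have "halts k Z bb t" by (simp add: fun_upd_idem)
  then show ?case using "2_2" unfolding strip_loop_def
    by (subst halts_While_step) (auto simp: scan_def stack_view_def elim!: halts_mono)
qed

lemma halts_move_loop:
  assumes "b \<noteq> d" "Z b = stack_view w" "Z d = (l, [])"
    and "halts k (Z(b := ([], []), d := (rev (gens w) @ l, []))) bb t"
  shows "halts (move_loop b d # k) Z bb (t + 4 * length w + 1)"
  using assms(2-)
proof (induction w arbitrary: Z l)
  case Nil
  then have "halts k Z bb t" by (simp add: fun_upd_idem stack_view_def)
  then show ?case using Nil unfolding move_loop_def
    by (subst halts_While_step) (auto simp: scan_def stack_view_def)
next
  case (Cons x w)
  have "halts (move_loop b d # k) (Z(d := (Input (Gen x) # l, []), b := stack_view w)) bb
     (t + 4 * length w + 1)"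
  proof (rule Cons.IH)
    show "halts k ((Z(d := (Input (Gen x) # l, []), b := stack_view w))(b := ([], []),
        d := (rev (gens w) @ Input (Gen x) # l, []))) bb t"
      by (rule halts_cong[OF Cons.prems(3)]) (use assms(1) in \<open>auto simp: fun_eq_iff\<close>)
  qed (use assms(1) in auto)
  then show ?case
    using Cons.prems assms(1) unfolding move_loop_def
    by (subst halts_While_step) (auto simp: halts_step scan_def stack_view_def elim!: halts_mono)
qed

definition normalise :: "nat \<Rightarrow> nat \<Rightarrow> nat \<Rightarrow> nat \<Rightarrow> letter prog" where
  "normalise z a b d = Cond (\<lambda>rd. rd z = Separator) (keep z Stay)
     (Seq (rewind a) (Seq (keep b Move_Left) (Seq (strip_loop a b) (Seq (move_loop b d) (rewind d)))))"

definition normal :: "nat \<Rightarrow> nat \<Rightarrow> nat \<Rightarrow> ltapes \<Rightarrow> nform \<Rightarrow> bool" where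
  "normal z a d Z s \<longleftrightarrow> (case s of None \<Rightarrow> Z z = ([], [Separator])
     | Some (\<alpha>, \<beta>) \<Rightarrow> Z z = ([], []) \<and> Z a = ([], gens (fst (strip \<alpha> \<beta>))) \<and> Z d = ([], gens (snd (strip \<alpha> \<beta>))))"

definition nf_size :: "nform \<Rightarrow> nat" where
  "nf_size s = (case s of None \<Rightarrow> 0 | Some (\<alpha>, \<beta>) \<Rightarrow> length \<alpha> + length \<beta>)"

lemma strip_length: "length (fst (strip xs ys)) \<le> length xs" "length (snd (strip xs ys)) \<le> length ys"
  by (induction xs ys rule: strip.induct) auto

lemma halts_normalise:
  assumes "distinct [z, a, b, d]" "parsed z a b Z s" "Z d = ([], [])"
    and "\<And>Z'. normal z a d Z' s \<Longrightarrow> \<forall>i. i \<notin> {z, a, b, d} \<longrightarrow> Z' i = Z i \<Longrightarrow> halts k Z' bb t"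
  shows "halts (normalise z a b d # k) Z bb (t + 12 * nf_size s + 40)"
proof (cases s)
  case None
  then have "halts k Z bb t" using assms by (auto simp: normal_def parsed_def)
  then show ?thesis using None assms(1,2) unfolding normalise_def
    by (auto simp: halts_step scan_def parsed_def fun_upd_idem elim!: halts_mono)
next
  case (Some \<alpha>\<beta>)
  obtain \<alpha> \<beta> where s: "s = Some (\<alpha>, \<beta>)" using Some by (cases \<alpha>\<beta>) auto
  obtain p q where pq: "strip \<alpha> \<beta> = (p, q)" by fastforce
  have len: "length q \<le> length \<beta>" using strip_length(2)[of \<alpha> \<beta>] pq by simp
  have Z: "Z z = ([], [])" "Z a = (rev (gens \<alpha>), [])" "Z b = (gens \<beta>, [])"
    using assms(2) by (auto simp: s parsed_def)
  define Z1 where "Z1 = Z(a := ([], gens \<alpha>), b := stack_view \<beta>)"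
  define Z2 where "Z2 = Z1(a := ([], gens p), b := stack_view q)"
  define Z3 where "Z3 = Z2(b := ([], []), d := (rev (gens q), []))"
  have "halts k (Z3(d := ([], gens q))) bb t"
    using assms(1,3) Z by (intro assms(4)) (auto simp: Z3_def Z2_def Z1_def normal_def s pq)
  then have "halts (rewind d # k) Z3 bb (t + 2 * length q + 10)"
    using halts_rewind[of Z3 d "rev (gens q)" "[]" k bb t] assms(1)
    by (auto simp: Z3_def rev_map[symmetric])
  then have "halts (move_loop b d # rewind d # k) Z2 bb (t + 2 * length q + 10 + 4 * length q + 1)"
    using assms(1,3) by (intro halts_move_loop) (auto simp: Z3_def Z2_def Z1_def)
  then have "halts (Seq (move_loop b d) (rewind d) # k) Z2 bb (t + 6 * length q + 12)"
    by (auto simp: halts_step elim!: halts_mono)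
  then have "halts (strip_loop a b # Seq (move_loop b d) (rewind d) # k) Z1 bb
      (t + 6 * length q + 12 + 4 * length \<alpha> + 1)"
    using assms(1) by (intro halts_strip_loop) (auto simp: Z2_def Z1_def pq)
  then have "halts (Seq (keep b Move_Left) (Seq (strip_loop a b) (Seq (move_loop b d) (rewind d))) # k)
      (Z(a := ([], gens \<alpha>))) bb (t + 6 * length q + 12 + 4 * length \<alpha> + 4)"
    using assms(1) Z
    by (auto simp: halts_step scan_def Z1_def stack_view_def elim!: halts_mono)
  then have "halts (rewind a # Seq (keep b Move_Left) (Seq (strip_loop a b) (Seq (move_loop b d) (rewind d))) # k)
      Z bb (t + 6 * length q + 12 + 4 * length \<alpha> + 4 + 2 * length \<alpha> + 10)"
    using Z(2) by (intro halts_rewind[of Z a "rev (gens \<alpha>)" "[]", simplified]) (auto simp: rev_map)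
  then show ?thesis
    using Z(1) len unfolding normalise_def
    by (auto simp: halts_step scan_def s nf_size_def elim!: halts_mono)
qed

lemma nf_size_step: "nf_size (nf_step s x) \<le> Suc (nf_size s)"
  by (cases "(s, x)" rule: nf_step.cases) (auto simp: nf_size_def split: list.splits)

lemma nf_size_nf: "nf_size (nf w) \<le> length w"
proof (induction w rule: rev_induct)
  case Nil
  then show ?case by (simp add: nf_def nf_size_def)
next
  case (snoc x w)
  then show ?case using nf_size_step[of "nf w" x] by (simp add: nf_def)
qed

definition analyse :: "nat \<Rightarrow> nat \<Rightarrow> nat \<Rightarrow> nat \<Rightarrow> letter prog" where
  "analyse z a b d = Seq (parse z a b) (normalise z a b d)"

text \<open>Arbitrary \<open>l\<close> and \<open>r\<close> let this serve both input words, the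
  first ended by the separator and the second by a blank. The rate 25 is 13 for parsing plus 12 for
  normalising, since \<open>nf_size (nf w)\<close> is at most \<open>length w\<close>.\<close>

lemma halts_analyse:
  assumes "distinct [0, z, a, b, d]" "\<forall>i\<in>{z, a, b, d}. Z i = ([], [])"
    "Z 0 = (l, map Input w @ r)" "\<not> is_input (bhd r)"
    and "\<And>Z'. Z' 0 = (rev (map Input w) @ l, r) \<Longrightarrow> normal z a d Z' (nf w) \<Longrightarrow>
      \<forall>i. i \<notin> {0, z, a, b, d} \<longrightarrow> Z' i = Z i \<Longrightarrow> halts k Z' bb t"
  shows "halts (analyse z a b d # k) Z bb (t + 25 * length w + 50)"
proof -
  have "halts (parse z a b # normalise z a b d # k) Z bb
      (t + 12 * nf_size (nf w) + 40 + 13 * length w + 1)"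
  proof (rule halts_parse[where s = "Some ([], [])", OF _ _ _ assms(4)])
    show "Z 0 = (l, map Input w @ r)" by (rule assms(3))
    show "parsed z a b Z (Some ([], []))" using assms(2) by (auto simp: parsed_def)
    fix Z' assume Z': "Z' 0 = (rev (map Input w) @ l, r)" "parsed z a b Z' (foldl nf_step (Some ([], [])) w)"
      "\<forall>i. i \<notin> {0, z, a, b} \<longrightarrow> Z' i = Z i"
    show "halts (normalise z a b d # k) Z' bb (t + 12 * nf_size (nf w) + 40)"
      using assms(1,2) Z'
      by (intro halts_normalise) (auto simp: nf_def intro!: assms(5))
  qed (use assms(1) in auto)
  then show ?thesis
    using nf_size_nf[of w] unfolding analyse_def by (auto simp: halts_step elim!: halts_mono)
qed

section \<open>Testing cyclic conjugacy\<close>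

text \<open>Running through both words in lockstep also compares their lengths: started at their
  beginnings, both source heads end on blanks only if the lengths agree.\<close>

definition copy_loop :: "nat \<Rightarrow> nat \<Rightarrow> nat \<Rightarrow> nat \<Rightarrow> letter prog" where
  "copy_loop s1 s2 e1 e2 = While (\<lambda>rd. rd s1 \<noteq> Blank \<and> rd s2 \<noteq> Blank)
     (Seq (Op e1 (\<lambda>rd. rd s1) Move_Right) (Seq (Op e2 (\<lambda>rd. rd s2) Move_Right)
       (Seq (keep s1 Move_Right) (keep s2 Move_Right))))"

lemma halts_copy_loop:
  assumes "distinct [s1, s2, e1, e2]"
    and "Z s1 = (l1, gens v)" "Z s2 = (l2, gens w)" "Z e1 = (m1, [])" "Z e2 = (m2, [])"
    and "n = min (length v) (length w)"
    and "\<And>Z'. Z' s1 = (rev (gens (take n v)) @ l1, gens (drop n v)) \<Longrightarrow>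
       Z' s2 = (rev (gens (take n w)) @ l2, gens (drop n w)) \<Longrightarrow>
       Z' e1 = (rev (gens (take n v)) @ m1, []) \<Longrightarrow> Z' e2 = (rev (gens (take n w)) @ m2, []) \<Longrightarrow>
       halts k Z' bb t"
  shows "halts (copy_loop s1 s2 e1 e2 # k) Z bb (t + 8 * n + 1)"
  using assms(2-)
proof (induction v arbitrary: w n Z l1 l2 m1 m2)
  case Nil
  then have "halts k Z bb t" by simp
  then show ?case using Nil(1) unfolding copy_loop_def
    by (subst halts_While_step) (auto simp: scan_def elim!: halts_mono)
next
  case (Cons x v)
  show ?case
  proof (cases w)
    case Nil
    then have "halts k Z bb t" using Cons.prems by simp
    then show ?thesis using Cons.prems(2) Nil unfolding copy_loop_def
      by (subst halts_While_step) (auto simp: scan_def elim!: halts_mono)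
  next
    case w: (Cons y w')
    define n' where "n' = min (length v) (length w')"
    have n: "n = Suc n'" using Cons.prems(5) w by (simp add: n'_def)
    define Z1 where "Z1 = Z(e1 := (Input (Gen x) # m1, []), e2 := (Input (Gen y) # m2, []),
      s1 := (Input (Gen x) # l1, gens v), s2 := (Input (Gen y) # l2, gens w'))"
    have "halts (copy_loop s1 s2 e1 e2 # k) Z1 bb (t + 8 * n' + 1)"
    proof (rule Cons.IH)
      show "Z1 s1 = (Input (Gen x) # l1, gens v)" "Z1 s2 = (Input (Gen y) # l2, gens w')"
        "Z1 e1 = (Input (Gen x) # m1, [])" "Z1 e2 = (Input (Gen y) # m2, [])"
        using assms(1) by (auto simp: Z1_def)
      fix Z' assume "Z' s1 = (rev (gens (take n' v)) @ Input (Gen x) # l1, gens (drop n' v))"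
        "Z' s2 = (rev (gens (take n' w')) @ Input (Gen y) # l2, gens (drop n' w'))"
        "Z' e1 = (rev (gens (take n' v)) @ Input (Gen x) # m1, [])"
        "Z' e2 = (rev (gens (take n' w')) @ Input (Gen y) # m2, [])"
      then show "halts k Z' bb t"
        by (intro Cons.prems(6)) (simp_all add: n w)
    qed (simp add: n'_def)
    then show ?thesis
      using Cons.prems(1-4) assms(1) unfolding copy_loop_def
      by (subst halts_While_step) (auto simp: halts_step scan_def w n Z1_def elim!: halts_mono)
  qed
qed

definition back_loop :: "nat \<Rightarrow> nat \<Rightarrow> letter prog" where
  "back_loop s e = While (\<lambda>rd. rd s \<noteq> Blank) (Seq (keep e Move_Left) (keep s Move_Left))"

text \<open>The head of \<open>s\<close> has already moved left onto \<open>x\<close>, so the loop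
  runs \<open>length u + 1\<close> times; accordingly \<open>e\<close> goes back over
  \<open>u'\<close> and \<open>y\<close>.\<close>

lemma halts_back_loop:
  assumes "s \<noteq> e" "Z s = (u, x # v)" "x \<noteq> Blank" "Blank \<notin> set u"
    and "Z e = (u' @ y # l, r)" "length u' = length u" "y \<noteq> Blank" "Blank \<notin> set u'" "Blank \<notin> set r"
    and "halts k (Z(s := ([], Blank # rev u @ x # v), e := (l, y # rev u' @ r))) bb t"
  shows "halts (back_loop s e # k) Z bb (t + 4 * length u + 5)"
  using assms(2-)
proof (induction u arbitrary: Z x v u' r)
  case Nil
  have *: "bcons y r = y # r" using Nil by auto
  show ?case
    using Nil assms(1) * unfolding back_loop_def
    by (auto simp: halts_step halts_While_step scan_def fun_upd_twist[OF assms(1)] intro!: halts_cong[OF Nil(9)])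
next
  case (Cons c u)
  obtain c' u'' where u': "u' = c' # u''" using Cons.prems(5) by (cases u') auto
  define Z1 where "Z1 = Z(e := (u'' @ y # l, c' # r), s := (u, c # x # v))"
  have "halts (back_loop s e # k) Z1 bb (t + 4 * length u + 5)"
  proof (rule Cons.IH)
    show "Z1 s = (u, c # x # v)" "Z1 e = (u'' @ y # l, c' # r)"
      using assms(1) by (auto simp: Z1_def)
    show "halts k (Z1(s := ([], Blank # rev u @ c # x # v), e := (l, y # rev u'' @ c' # r))) bb t"
      by (rule halts_cong[OF Cons.prems(9)]) (use assms(1) in \<open>auto simp: Z1_def fun_eq_iff u'\<close>)
  qed (use Cons.prems u' in auto)
  moreover have "bcons c' r = c' # r" using Cons.prems(7) u' by auto
  ultimately show ?case
    using Cons.prems(1-8) assms(1) unfolding back_loop_def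
    by (subst halts_While_step) (auto simp: halts_step scan_def Z1_def u' elim!: halts_mono)
qed

text \<open>Tape \<open>s\<close> is used as a unary counter: its head is as many cells from the left end of its word as
  the head of \<open>e2\<close> has to go back.\<close>

definition skip_back :: "nat \<Rightarrow> nat \<Rightarrow> nat \<Rightarrow> letter prog" where
  "skip_back s e1 e2 = Seq (keep e1 Move_Right) (Seq (keep s Move_Left)
     (Seq (back_loop s e2) (keep s Move_Right)))"

lemma halts_skip_back:
  assumes "distinct [s, e1, e2]" "Z s = (u, v)" "Blank \<notin> set u" "Blank \<notin> set v"
    and "Z e1 = (l1, c # r1)" "c \<noteq> Blank"
    and "Z e2 = (u' @ l, r)" "length u' = length u" "Blank \<notin> set u'" "Blank \<notin> set r"
    and "halts k (Z(s := ([], rev u @ v), e1 := (c # l1, r1), e2 := (l, rev u' @ r))) bb t"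
  shows "halts (skip_back s e1 e2 # k) Z bb (t + 4 * length u + 12)"
proof (cases u)
  case Nil
  have Z': "Z(s := ([], rev u @ v), e1 := (c # l1, r1), e2 := (l, rev u' @ r)) =
      Z(e1 := (c # l1, r1), s := ([], v))"
    using assms Nil by (auto simp: fun_eq_iff)
  have v: "bcons Blank v = (if v = [] then [] else Blank # v)" by (auto simp: bcons_def)
  show ?thesis
    using assms(1-10) Nil assms(11)[unfolded Z'] unfolding skip_back_def back_loop_def
    by (auto simp: halts_step halts_While_step scan_def v elim!: halts_mono)
next
  case (Cons x us)
  then obtain y us' where u': "u' = us' @ [y]" using assms(8) by (cases u' rule: rev_cases) auto
  have v: "bcons x v = x # v" using assms(3) Cons by auto
  define Z1 where "Z1 = Z(e1 := (c # l1, r1), s := (us, x # v))"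
  have "halts (back_loop s e2 # keep s Move_Right # k) Z1 bb (t + 1 + 4 * length us + 5)"
  proof (rule halts_back_loop)
    show "Z1 s = (us, x # v)" "Z1 e2 = (us' @ y # l, r)" "s \<noteq> e2"
      using assms(1,7) by (auto simp: Z1_def u')
    have "halts k (Z1(s := ([], rev us @ x # v), e2 := (l, y # rev us' @ r))) bb t"
      by (rule halts_cong[OF assms(11)]) (use assms(1) in \<open>auto simp: Z1_def fun_eq_iff u' Cons\<close>)
    then show "halts (keep s Move_Right # k)
       (Z1(s := ([], Blank # rev us @ x # v), e2 := (l, y # rev us' @ r))) bb (t + 1)"
      using assms(1) by (auto simp: halts_step scan_def fun_upd_twist)
  qed (use assms(3,4,8-10) u' Cons in auto)
  then show ?thesis
    using assms(1-10) Cons v unfolding skip_back_def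
    by (auto simp: halts_step scan_def Z1_def elim!: halts_mono)
qed

fun less_sym :: "letter tape_symbol \<Rightarrow> letter tape_symbol \<Rightarrow> bool" where
  "less_sym (Input (Gen i)) (Input (Gen j)) \<longleftrightarrow> i < j"
| "less_sym _ _ \<longleftrightarrow> False"

definition compare_body :: "nat \<Rightarrow> nat \<Rightarrow> nat \<Rightarrow> letter prog" where
  "compare_body s e1 e2 =
     (Cond (\<lambda>rd. rd e1 = rd e2)
       (Seq (keep e1 Move_Right) (Seq (keep e2 Move_Right) (keep s Move_Right)))
       (Cond (\<lambda>rd. less_sym (rd e2) (rd e1)) (skip_back s e1 e2) (skip_back s e2 e1)))"

text \<open>The counter tape \<open>s\<close> carries a copy of \<open>w\<close>, so its head leaves
  the word exactly when a full turn has matched. This is why a blank on \<open>s\<close> means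
  acceptance afterwards.\<close>

definition compare_loop :: "nat \<Rightarrow> nat \<Rightarrow> nat \<Rightarrow> letter prog" where
  "compare_loop s e1 e2 = While (\<lambda>rd. rd s \<noteq> Blank \<and> rd e1 \<noteq> Blank \<and> rd e2 \<noteq> Blank)
     (compare_body s e1 e2)"

definition compare :: "nat \<Rightarrow> nat \<Rightarrow> nat \<Rightarrow> letter prog" where
  "compare s e1 e2 = Seq (compare_loop s e1 e2) (Cond (\<lambda>rd. rd s = Blank) (Done True) (Done False))"

definition tape_at :: "nat \<Rightarrow> nat list \<Rightarrow> letter ztape" where
  "tape_at i w = (rev (gens (take i w)), gens (drop i w))"

lemma tape_at_scan: "i < length w \<Longrightarrow> bhd (snd (tape_at i w)) = Input (Gen (w ! i))"
  "length w \<le> i \<Longrightarrow> bhd (snd (tape_at i w)) = Blank"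
  by (auto simp: tape_at_def Cons_nth_drop_Suc[symmetric])

lemma tape_at_right: "i < length w \<Longrightarrow> ztape_act (bhd (snd (tape_at i w))) Move_Right (tape_at i w) = tape_at (Suc i) w"
  by (auto simp: tape_at_def Cons_nth_drop_Suc[symmetric] take_Suc_conv_app_nth)

lemma tape_at_Suc: "i < length w \<Longrightarrow> tape_at i w = (rev (gens (take i w)), Input (Gen (w ! i)) # gens (drop (Suc i) w))"
  "i < length w \<Longrightarrow> tape_at (Suc i) w = (Input (Gen (w ! i)) # rev (gens (take i w)), gens (drop (Suc i) w))"
  by (auto simp: tape_at_def Cons_nth_drop_Suc[symmetric] take_Suc_conv_app_nth)

lemma tape_at_split: "j + k \<le> length w \<Longrightarrow> tape_at (j + k) w =
    (rev (gens (take k (drop j w))) @ rev (gens (take j w)), gens (drop (j + k) w))"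
  by (simp add: tape_at_def take_add)

lemma tape_at_split': "j + k \<le> length w \<Longrightarrow> tape_at j w =
    (rev (gens (take j w)), gens (take k (drop j w)) @ gens (drop (j + k) w))"
  unfolding tape_at_def map_append[symmetric] by (metis add.commute append_take_drop_id drop_drop)

lemma halts_skip_back_at:
  assumes "distinct [s, e1, e2]" "Z s = tape_at k u" "k \<le> length u"
    and "Z e1 = tape_at i v" "i < length v" "Z e2 = tape_at (j + k) w" "j + k \<le> length w"
    and "halts ks (Z(s := tape_at 0 u, e1 := tape_at (Suc i) v, e2 := tape_at j w)) bb t"
  shows "halts (skip_back s e1 e2 # ks) Z bb (t + 4 * k + 12)"
proof -
  have l: "length (rev (gens (take k u))) = k" using assms(3) by simp
  have "halts (skip_back s e1 e2 # ks) Z bb (t + 4 * length (rev (gens (take k u))) + 12)"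
  proof (rule halts_skip_back[OF assms(1)])
    show "Z s = (rev (gens (take k u)), gens (drop k u))" using assms by (simp add: tape_at_def)
    show "Z e1 = (rev (gens (take i v)), Input (Gen (v ! i)) # gens (drop (Suc i) v))"
      using assms by (simp add: tape_at_Suc)
    show "Z e2 = (rev (gens (take k (drop j w))) @ rev (gens (take j w)), gens (drop (j + k) w))"
      using assms by (simp add: tape_at_split)
    show "halts ks (Z(s := ([], rev (rev (gens (take k u))) @ gens (drop k u)),
       e1 := (Input (Gen (v ! i)) # rev (gens (take i v)), gens (drop (Suc i) v)),
       e2 := (rev (gens (take j w)), rev (rev (gens (take k (drop j w)))) @ gens (drop (j + k) w)))) bb t"
    proof (rule halts_cong[OF assms(8)])
      have "rev (rev (gens (take k u))) @ gens (drop k u) = gens u"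
        by (simp flip: map_append)
      then show "Z(s := ([], rev (rev (gens (take k u))) @ gens (drop k u)),
         e1 := (Input (Gen (v ! i)) # rev (gens (take i v)), gens (drop (Suc i) v)),
         e2 := (rev (gens (take j w)), rev (rev (gens (take k (drop j w)))) @ gens (drop (j + k) w))) =
         Z(s := tape_at 0 u, e1 := tape_at (Suc i) v, e2 := tape_at j w)"
        using tape_at_split'[OF assms(7)] assms(5) by (simp add: tape_at_Suc) (simp add: tape_at_def)
    qed simp
  qed (use assms(3,7) in auto)
  then show ?thesis unfolding l .
qed

text \<open>The time bound is also the induction measure.  Each matching step releases 8 units of it, and a
  jump over \<open>k + 1\<close> positions at least \<open>12 * k + 20\<close>, enough to move a head back by \<open>k\<close>.\<close>

lemma halts_compare_loop:
  assumes d: "distinct [s, e1, e2]" and len: "length v = length w"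
    and "beaten v w i" "beaten w v j" "i + k \<le> 2 * length w" "j + k \<le> 2 * length w" "k \<le> length w"
    and "\<And>t. t < k \<Longrightarrow> (w @ w) ! (i + t) = (v @ v) ! (j + t)"
    and "Z s = tape_at k w" "Z e1 = tape_at (i + k) (w @ w)" "Z e2 = tape_at (j + k) (v @ v)"
  shows "halts (compare_loop s e1 e2 # Cond (\<lambda>rd. rd s = Blank) (Done True) (Done False) # ks) Z
     (cyclic w v) (20 * (4 * length w - (i + j)) - 8 * k + 5)"
  using assms(3-)
\<comment> \<open>As \<open>i + k\<close> and \<open>j + k\<close> are at most
  \<open>2 * length w\<close>, the difference \<open>4 * length w - (i + j)\<close> is at least
  \<open>2 * k\<close>, so the natural-number subtractions are never truncated.\<close>
proof (induction "20 * (4 * length w - (i + j)) - 8 * k" arbitrary: i j k Z rule: less_induct)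
  case less
  let ?P = "Cond (\<lambda>rd. rd s = Blank) (Done True) (Done False)"
  note inv = less.prems
  have rds: "scan Z s = (if k < length w then Input (Gen (w ! k)) else Blank)"
    using inv tape_at_scan[where i = k and w = w] by (auto simp: scan_def)
  have rd1: "scan Z e1 = (if i + k < 2 * length w then Input (Gen ((w @ w) ! (i + k))) else Blank)"
    using inv tape_at_scan[where i = "i + k" and w = "w @ w"] by (auto simp: scan_def mult_2)
  have rd2: "scan Z e2 = (if j + k < 2 * length w then Input (Gen ((v @ v) ! (j + k))) else Blank)"
    using inv tape_at_scan[where i = "j + k" and w = "v @ v"] len by (auto simp: scan_def mult_2)
  show ?case
  proof (cases "k < length w \<and> i + k < 2 * length w \<and> j + k < 2 * length w")
    case False
    have "cyclic w v" if "k = length w"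
      using inv that len by (intro matched_cyclic[of v w i j]) auto
    moreover have "\<not> cyclic w v" if "k < length w"
    proof -
      \<comment> \<open>A head at the end of its doubled word before a full turn has matched must
        have started beyond the first copy.\<close>
      from that False inv consider "length w \<le> i" | "length v \<le> j" by (auto simp: len)
      then show ?thesis
        using beaten_not_cyclic[of v w i] beaten_not_cyclic[of w v j] inv(1,2) that len cyclic_sym
        by cases fastforce+
    qed
    moreover have "k = length w \<or> k < length w" using inv by auto
    ultimately show ?thesis
      using False unfolding compare_loop_def
      by (subst halts_While_step) (auto simp: halts_step rds rd1 rd2)
  next
    case True
    note wv = \<open>k < length w \<and> _\<close>
    let ?x = "(w @ w) ! (i + k)" and ?y = "(v @ v) ! (j + k)"
    have body: "halts (compare_body s e1 e2 # compare_loop s e1 e2 # ?P # ks) Z (cyclic w v)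
        (20 * (4 * length w - (i + j)) - 8 * k + 4)"
    proof -
      consider "?x = ?y" | "?y < ?x" | "?x < ?y" by linarith
      then show ?thesis
      proof cases
        case 1
        define Z1 where "Z1 = Z(e1 := tape_at (Suc (i + k)) (w @ w), e2 := tape_at (Suc (j + k)) (v @ v), s := tape_at (Suc k) w)"
        have "halts (compare_loop s e1 e2 # ?P # ks) Z1 (cyclic w v)
           (20 * (4 * length w - (i + j)) - 8 * Suc k + 5)"
        proof (rule less.hyps)
          show "(w @ w) ! (i + t) = (v @ v) ! (j + t)" if "t < Suc k" for t
            using that 1 inv(6) by (cases "t = k") auto
        qed (use inv True d in \<open>auto simp: Z1_def\<close>)
        moreover have "ztape_act (scan Z e1) Move_Right (Z e1) = tape_at (Suc (i + k)) (w @ w)"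
          "ztape_act (scan Z e2) Move_Right (Z e2) = tape_at (Suc (j + k)) (v @ v)"
          "ztape_act (scan Z s) Move_Right (Z s) = tape_at (Suc k) w"
          using inv True len tape_at_right[of "i + k" "w @ w"] tape_at_right[of "j + k" "v @ v"] tape_at_right[of k w]
          by (simp_all add: scan_def)
        moreover have "bhd (snd (Z e1)) = bhd (snd (Z e2))"
          using rd1 rd2 1 True by (simp add: scan_def)
        ultimately show ?thesis
          using True d inv(3-5,7-9) unfolding compare_body_def
          by (auto simp: halts_step Z1_def scan_def elim!: halts_mono)
      next
        case 2
        define Z1 where "Z1 = Z(s := tape_at 0 w, e1 := tape_at (Suc (i + k)) (w @ w), e2 := tape_at j (v @ v))"
        have "halts (compare_loop s e1 e2 # ?P # ks) Z1 (cyclic w v)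
           (20 * (4 * length w - (Suc (i + k) + j)) - 8 * 0 + 5)"
        proof (rule less.hyps)
          show "beaten v w (Suc (i + k))"
            using beaten_step[OF len _ inv(1), of k j] inv(6) True 2 by simp
        qed (use inv True d in \<open>auto simp: Z1_def\<close>)
        then have "halts (skip_back s e1 e2 # compare_loop s e1 e2 # ?P # ks) Z (cyclic w v)
           (20 * (4 * length w - (Suc (i + k) + j)) - 8 * 0 + 5 + 4 * k + 12)"
          using d inv True len by (intro halts_skip_back_at[where u = w and v = "w @ w" and w = "v @ v"
            and i = "i + k" and j = j]) (auto simp: Z1_def)
        then show ?thesis
          using 2 True unfolding compare_body_def
          by (auto simp: halts_step rd1 rd2 elim!: halts_mono)
      next
        case 3
        define Z1 where "Z1 = Z(s := tape_at 0 w, e2 := tape_at (Suc (j + k)) (v @ v), e1 := tape_at i (w @ w))"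
        have "halts (compare_loop s e1 e2 # ?P # ks) Z1 (cyclic w v)
           (20 * (4 * length w - (i + Suc (j + k))) - 8 * 0 + 5)"
        proof (rule less.hyps)
          show "beaten w v (Suc (j + k))"
            using beaten_step[OF len[symmetric] _ inv(2), of k i] inv(6) True 3 len by simp
        qed (use inv True d in \<open>auto simp: Z1_def\<close>)
        then have "halts (skip_back s e2 e1 # compare_loop s e1 e2 # ?P # ks) Z (cyclic w v)
           (20 * (4 * length w - (i + Suc (j + k))) - 8 * 0 + 5 + 4 * k + 12)"
          using d inv True len by (intro halts_skip_back_at[where u = w and v = "v @ v" and w = "w @ w"
            and i = "j + k" and j = i]) (auto simp: Z1_def)
        then show ?thesis
          using 3 True unfolding compare_body_def
          by (auto simp: halts_step rd1 rd2 elim!: halts_mono)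
      qed
    qed
    show ?thesis
      using body True unfolding compare_loop_def
      by (subst halts_While_step) (auto simp: rds rd1 rd2 elim!: halts_mono)
  qed
qed

text \<open>The heads of \<open>e1\<close> and \<open>e2\<close> are not rewound between the two
  passes, so the second pass appends a second copy. Afterwards \<open>s1\<close>, still holding the
  first word, becomes the counter.\<close>

definition cyclic_test :: "nat \<Rightarrow> nat \<Rightarrow> nat \<Rightarrow> nat \<Rightarrow> letter prog" where
  "cyclic_test s1 s2 e1 e2 = Seq (copy_loop s1 s2 e1 e2) (Cond (\<lambda>rd. rd s1 = rd s2)
     (Seq (rewind s1) (Seq (rewind s2) (Seq (copy_loop s1 s2 e1 e2) (Seq (rewind s1)
       (Seq (rewind e1) (Seq (rewind e2) (compare s1 e1 e2)))))))
     (Done False))"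

text \<open>The length of \<open>w\<close> alone bounds the time: the first pass stops with the
  shorter word, and the later phases run only for equal lengths.\<close>

lemma halts_cyclic_test:
  assumes d: "distinct [s1, s2, e1, e2]"
    and "Z s1 = ([], gens w)" "Z s2 = ([], gens v)" "Z e1 = ([], [])" "Z e2 = ([], [])"
  shows "halts (cyclic_test s1 s2 e1 e2 # ks) Z (cyclic w v) (150 * length w + 200)"
proof -
  let ?c = "\<lambda>ks. Cond (\<lambda>rd. rd s1 = rd s2)
     (Seq (rewind s1) (Seq (rewind s2) (Seq (copy_loop s1 s2 e1 e2) (Seq (rewind s1)
       (Seq (rewind e1) (Seq (rewind e2) (compare s1 e1 e2)))))))
     (Done False) # ks"
  have "halts (copy_loop s1 s2 e1 e2 # ?c ks) Z (cyclic w v)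
     (100 + 130 * length w + 8 * min (length w) (length v) + 1)"
  proof (rule halts_copy_loop[OF assms HOL.refl])
    fix Z1 :: ltapes
    let ?n = "min (length w) (length v)"
    assume Z1: "Z1 s1 = (rev (gens (take ?n w)) @ [], gens (drop ?n w))"
      "Z1 s2 = (rev (gens (take ?n v)) @ [], gens (drop ?n v))"
      "Z1 e1 = (rev (gens (take ?n w)) @ [], [])" "Z1 e2 = (rev (gens (take ?n v)) @ [], [])"
    show "halts (?c ks) Z1 (cyclic w v) (100 + 130 * length w)"
    proof (cases "length w = length v")
      case False
      then have "scan Z1 s1 \<noteq> scan Z1 s2"
        using Z1(1,2) by (cases "length w < length v") (auto simp: scan_def min_def)
      then show ?thesis
        using False cyclic_length[of w v] by (auto simp: halts_step)
    next
      case True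
      have Z1: "Z1 s1 = (rev (gens w), [])" "Z1 s2 = (rev (gens v), [])"
        "Z1 e1 = (rev (gens w), [])" "Z1 e2 = (rev (gens v), [])"
        using Z1 True by auto
      define Z2 where "Z2 = Z1(s1 := ([], gens w), s2 := ([], gens v))"
      have final: "halts (Seq (rewind s1) (Seq (rewind e1) (Seq (rewind e2) (compare s1 e1 e2))) # ks) Z3
           (cyclic w v) (90 * length w + 53)"
        if Z3: "Z3 s1 = (rev (gens w), [])" "Z3 e1 = (rev (gens (w @ w)), [])"
          "Z3 e2 = (rev (gens (v @ v)), [])" for Z3
      proof -
        define Z4 where "Z4 = Z3(s1 := ([], gens w), e1 := ([], gens (w @ w)), e2 := ([], gens (v @ v)))"
        have "halts (compare_loop s1 e1 e2 # Cond (\<lambda>rd. rd s1 = Blank) (Done True) (Done False) # ks) Z4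
           (cyclic w v) (20 * (4 * length w - (0 + 0)) - 8 * 0 + 5)"
          using d True by (intro halts_compare_loop) (auto simp: Z4_def tape_at_def)
        then have "halts (compare s1 e1 e2 # ks) Z4 (cyclic w v) (80 * length w + 6)"
          by (auto simp: halts_step compare_def elim!: halts_mono)
        then have "halts (rewind e2 # compare s1 e1 e2 # ks)
            (Z3(s1 := ([], gens w), e1 := ([], gens (w @ w)))) (cyclic w v)
            (80 * length w + 6 + 2 * length (rev (gens (v @ v))) + 10)"
          using d Z3 by (intro halts_rewind[where u = "rev (gens (v @ v))" and v = "[]"])
             (auto simp: Z4_def)
        then have "halts (rewind e1 # Seq (rewind e2) (compare s1 e1 e2) # ks)
            (Z3(s1 := ([], gens w))) (cyclic w v)
            (80 * length w + 17 + 4 * length v + 2 * length (rev (gens (w @ w))) + 10)"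
          using d Z3 by (intro halts_rewind[where u = "rev (gens (w @ w))" and v = "[]"])
            (auto simp: halts_step elim!: halts_mono)
        then have "halts (rewind s1 # Seq (rewind e1) (Seq (rewind e2) (compare s1 e1 e2)) # ks) Z3
            (cyclic w v) (84 * length w + 28 + 4 * length v + 2 * length (rev (gens w)) + 10)"
          using d Z3 by (intro halts_rewind[where u = "rev (gens w)" and v = "[]"])
            (auto simp: halts_step elim!: halts_mono)
        then show ?thesis using True by (auto simp: halts_step elim!: halts_mono)
      qed
      have "halts (copy_loop s1 s2 e1 e2 # Seq (rewind s1) (Seq (rewind e1) (Seq (rewind e2) (compare s1 e1 e2))) # ks)
         Z2 (cyclic w v) (90 * length w + 53 + 8 * length w + 1)"
      proof (rule halts_copy_loop[OF d])
        show "Z2 s1 = ([], gens w)" "Z2 s2 = ([], gens v)" "Z2 e1 = (rev (gens w), [])"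
          "Z2 e2 = (rev (gens v), [])" "length w = min (length w) (length v)"
          using Z1 d True by (auto simp: Z2_def)
        fix Z3 :: ltapes
        assume "Z3 s1 = (rev (gens (take (length w) w)) @ [], gens (drop (length w) w))"
          "Z3 e1 = (rev (gens (take (length w) w)) @ rev (gens w), [])"
          "Z3 e2 = (rev (gens (take (length w) v)) @ rev (gens v), [])"
        then show "halts (Seq (rewind s1) (Seq (rewind e1) (Seq (rewind e2) (compare s1 e1 e2))) # ks)
           Z3 (cyclic w v) (90 * length w + 53)"
          using True by (intro final) auto
      qed
      then have "halts (rewind s2 # Seq (copy_loop s1 s2 e1 e2) (Seq (rewind s1) (Seq (rewind e1) (Seq (rewind e2) (compare s1 e1 e2)))) # ks)
         (Z1(s1 := ([], gens w))) (cyclic w v) (98 * length w + 55 + 2 * length (rev (gens v)) + 10)"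
        using d Z1 by (intro halts_rewind[where u = "rev (gens v)" and v = "[]"])
          (auto simp: Z2_def halts_step elim!: halts_mono)
      then have "halts (rewind s1 # Seq (rewind s2) (Seq (copy_loop s1 s2 e1 e2) (Seq (rewind s1) (Seq (rewind e1) (Seq (rewind e2) (compare s1 e1 e2))))) # ks)
         Z1 (cyclic w v) (100 * length w + 66 + 2 * length (rev (gens w)) + 10)"
        using d Z1 True by (intro halts_rewind[where u = "rev (gens w)" and v = "[]"])
          (auto simp: halts_step elim!: halts_mono)
      then show ?thesis
        using Z1 by (auto simp: halts_step scan_def elim!: halts_mono)
    qed
  qed
  then show ?thesis unfolding cyclic_test_def
    by (auto simp: halts_step elim!: halts_mono)
qed

section \<open>The decision procedure\<close>

definition equal_loop :: "nat \<Rightarrow> nat \<Rightarrow> letter prog" where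
  "equal_loop a b = While (\<lambda>rd. rd a \<noteq> Blank \<and> rd a = rd b) (Seq (keep a Move_Right) (keep b Move_Right))"

definition equal_then :: "nat \<Rightarrow> nat \<Rightarrow> letter prog \<Rightarrow> letter prog" where
  "equal_then a b P = Seq (equal_loop a b) (Cond (\<lambda>rd. rd a = rd b) P (Done False))"

lemma halts_equal_loop:
  assumes "a \<noteq> b" "Z a = (l, gens v)" "Z b = (m, gens w)"
    and "\<And>Z'. scan Z' a = scan Z' b \<longleftrightarrow> v = w \<Longrightarrow> \<forall>i. i \<notin> {a, b} \<longrightarrow> Z' i = Z i \<Longrightarrow> halts k Z' bb t"
  shows "halts (equal_loop a b # k) Z bb (t + 4 * length v + 1)"
  using assms(2-)
proof (induction v arbitrary: Z w l m)
  case Nil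
  have "halts k Z bb t" using Nil(1,2) by (intro Nil(3)) (auto simp: scan_def)
  then show ?case using Nil(1) unfolding equal_loop_def
    by (subst halts_While_step) (auto simp: scan_def elim!: halts_mono)
next
  case (Cons x v)
  show ?case
  proof (cases "\<exists>w'. w = x # w'")
    case False
    then have "scan Z a \<noteq> scan Z b"
      using Cons.prems(1,2) by (cases w) (auto simp: scan_def)
    then have "halts k Z bb t" using False by (intro Cons.prems(3)) auto
    then show ?thesis using \<open>scan Z a \<noteq> scan Z b\<close> unfolding equal_loop_def
      by (subst halts_While_step) (auto elim!: halts_mono)
  next
    case True
    then obtain w' where w: "w = x # w'" by blast
    define Z1 where "Z1 = Z(a := (Input (Gen x) # l, gens v), b := (Input (Gen x) # m, gens w'))"
    have "halts (equal_loop a b # k) Z1 bb (t + 4 * length v + 1)"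
    proof (rule Cons.IH)
      fix Z' assume "(scan Z' a = scan Z' b) = (v = w')" "\<forall>i. i \<notin> {a, b} \<longrightarrow> Z' i = Z1 i"
      then show "halts k Z' bb t" by (intro Cons.prems(3)) (auto simp: w Z1_def)
    qed (use assms(1) in \<open>auto simp: Z1_def\<close>)
    then show ?thesis
      using Cons.prems(1,2) assms(1) unfolding equal_loop_def
      by (subst halts_While_step) (auto simp: halts_step scan_def w Z1_def elim!: halts_mono)
  qed
qed

lemma halts_equal_then:
  assumes "a \<noteq> b" "Z a = (l, gens v)" "Z b = (m, gens w)" "v \<noteq> w \<Longrightarrow> \<not> bb"
    and "\<And>Z'. v = w \<Longrightarrow> \<forall>i. i \<notin> {a, b} \<longrightarrow> Z' i = Z i \<Longrightarrow> halts (P # k) Z' bb t"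
  shows "halts (equal_then a b P # k) Z bb (t + 4 * length v + 4)"
proof -
  have "halts (equal_loop a b # Cond (\<lambda>rd. rd a = rd b) P (Done False) # k) Z bb (t + 2 + 4 * length v + 1)"
  proof (rule halts_equal_loop[OF assms(1-3)])
    fix Z' assume "scan Z' a = scan Z' b \<longleftrightarrow> v = w" "\<forall>i. i \<notin> {a, b} \<longrightarrow> Z' i = Z i"
    then show "halts (Cond (\<lambda>rd. rd a = rd b) P (Done False) # k) Z' bb (t + 2)"
      using assms(4) by (auto simp: halts_step intro!: halts_mono[OF assms(5)])
  qed
  then show ?thesis unfolding equal_then_def
    by (auto simp: halts_step elim!: halts_mono)
qed

text \<open>The tapes of \<open>x\<close> are 1 (zero flag), 2 (\<open>p\<close>), 3 (stack) and 4 (\<open>q\<close>), those of \<open>y\<close> are 5 to 8;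
  tapes 9 and 10 hold the doubled words.\<close>

definition decide :: "bool \<Rightarrow> letter prog" where
  "decide pmode =
     Cond (\<lambda>rd. rd 1 = Separator)
       (Cond (\<lambda>rd. rd 5 = Separator) (Done True)
         (Cond (\<lambda>rd. pmode \<and> rd 6 \<noteq> Blank \<and> rd 8 \<noteq> Blank) (Done True) (Done False)))
       (Cond (\<lambda>rd. rd 5 = Separator)
         (Cond (\<lambda>rd. pmode \<and> rd 2 \<noteq> Blank \<and> rd 4 \<noteq> Blank) (Done True) (Done False))
         (Cond (\<lambda>rd. pmode \<and> rd 4 = Blank \<and> rd 8 = Blank) (cyclic_test 2 6 9 10)
           (Cond (\<lambda>rd. rd 2 = Blank \<and> rd 6 = Blank) (cyclic_test 4 8 9 10)
             (equal_then 2 6 (equal_then 4 8 (Done True))))))"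

definition conj_test :: "bool \<Rightarrow> nform \<Rightarrow> nform \<Rightarrow> bool" where
  "conj_test pmode = (if pmode then p_test else c_test)"

lemma halts_decide:
  assumes "normal 1 2 4 Z s" "normal 5 6 8 Z t" "Z 9 = ([], [])" "Z 10 = ([], [])"
  shows "halts (decide pmode # k) Z (conj_test pmode s t) (150 * nf_size s + 300)"
proof -
  consider "s = None" | a b where "s = Some (a, b)" "t = None"
    | a b c d where "s = Some (a, b)" "t = Some (c, d)" by (cases s; cases t) auto
  then show ?thesis
  proof cases
    case 1
    then show ?thesis
      using assms(1,2) unfolding decide_def
      by (cases t) (auto simp: halts_step scan_def normal_def conj_test_def p_test_def c_test_def)
  next
    case 2
    then show ?thesis
      using assms(1,2) unfolding decide_def
      by (auto simp: halts_step scan_def normal_def conj_test_def p_test_def c_test_def)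
  next
    case 3
    obtain p q where pq: "strip a b = (p, q)" by fastforce
    obtain p' q' where pq': "strip c d = (p', q')" by fastforce
    have len: "length p \<le> nf_size s" "length q \<le> nf_size s" "length p + length q \<le> nf_size s"
      using strip_length[of a b] pq by (auto simp: 3 nf_size_def)
    have Z: "Z 1 = ([], [])" "Z 5 = ([], [])" "Z 2 = ([], gens p)" "Z 4 = ([], gens q)"
      "Z 6 = ([], gens p')" "Z 8 = ([], gens q')"
      using assms(1,2) by (auto simp: 3 normal_def pq pq')
    have t1: "halts (cyclic_test 2 6 9 10 # k) Z (cyclic p p') (150 * nf_size s + 290)"
      by (rule halts_mono[OF halts_cyclic_test[of 2 6 9 10 Z p p' k]]) (use Z assms len in auto)
    have t2: "halts (cyclic_test 4 8 9 10 # k) Z (cyclic q q') (150 * nf_size s + 290)"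
      by (rule halts_mono[OF halts_cyclic_test[of 4 8 9 10 Z q q' k]]) (use Z assms len in auto)
    have "halts (equal_then 2 6 (equal_then 4 8 (Done True)) # k) Z (p = p' \<and> q = q')
       (1 + 4 * length q + 4 + 4 * length p + 4)"
    proof (rule halts_equal_then)
      fix Z' assume "p = p'" and Z': "\<forall>i. i \<notin> {2, 6} \<longrightarrow> Z' i = Z i"
      show "halts (equal_then 4 8 (Done True) # k) Z' (p = p' \<and> q = q') (1 + 4 * length q + 4)"
      proof (rule halts_equal_then)
        show "Z' 4 = ([], gens q)" "Z' 8 = ([], gens q')" using Z Z' by simp_all
      qed (use \<open>p = p'\<close> in \<open>auto simp: halts_step\<close>)
    qed (use Z in auto)
    then have t3: "halts (equal_then 2 6 (equal_then 4 8 (Done True)) # k) Z (p = p' \<and> q = q')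
       (150 * nf_size s + 290)"
      by (rule halts_mono) (use len in simp)
    \<comment> \<open>Equality of remainders needs no separate check in the first two branches,
      because \<open>cyclic\<close> is reflexive. If both cyclic cases apply, all four remainders
      are empty.\<close>
    have "conj_test pmode s t = (if pmode \<and> q = [] \<and> q' = [] then cyclic p p'
      else if p = [] \<and> p' = [] then cyclic q q' else p = p' \<and> q = q')"
      by (auto simp: conj_test_def p_test_def c_test_def 3 pq pq')
    then show ?thesis
      using t1 t2 t3 Z unfolding decide_def
      by (auto simp: halts_step scan_def elim!: halts_mono)
  qed
qed

definition conjugacy_prog :: "bool \<Rightarrow> letter prog" where
  "conjugacy_prog pmode = Seq (analyse 1 2 3 4) (Seq (keep 0 Move_Right)
     (Seq (analyse 5 6 7 8) (decide pmode)))"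

text \<open>The rate 200 is 25 for analysing each word plus 150 for the decision, which is charged
  to \<open>x\<close> alone.\<close>

lemma halts_conjugacy_prog:
  "halts [conjugacy_prog pmode] (input_tapes x y) (conj_test pmode (nf x) (nf y))
     (200 * max (length x) (length y) + 500)"
proof -
  let ?b = "conj_test pmode (nf x) (nf y)"
  let ?k2 = "Seq (keep 0 Move_Right) (Seq (analyse 5 6 7 8) (decide pmode))"
  let ?T = "150 * length x + 300"
  have "halts (analyse 1 2 3 4 # [?k2]) (input_tapes x y) ?b
      (?T + 25 * length y + 50 + 4 + 25 * length x + 50)"
  proof (rule halts_analyse[where w = x and l = "[]" and r = "Separator # map Input y"])
    fix Z1 assume Z1: "Z1 0 = (rev (map Input x) @ [], Separator # map Input y)"
      "normal 1 2 4 Z1 (nf x)" "\<forall>i. i \<notin> {0, 1, 2, 3, 4} \<longrightarrow> Z1 i = input_tapes x y i"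
    define Z2 where "Z2 = Z1(0 := (Separator # rev (map Input x), map Input y @ []))"
    have "halts (analyse 5 6 7 8 # [decide pmode]) Z2 ?b (?T + 25 * length y + 50)"
    proof (rule halts_analyse)
      show "Z2 0 = (Separator # rev (map Input x), map Input y @ [])" by (simp add: Z2_def)
      show "\<forall>i\<in>{5, 6, 7, 8}. Z2 i = ([], [])" using Z1(3) by (simp add: Z2_def input_tapes_def)
      fix Z3 assume Z3: "normal 5 6 8 Z3 (nf y)" "\<forall>i. i \<notin> {0, 5, 6, 7, 8} \<longrightarrow> Z3 i = Z2 i"
      have "normal 1 2 4 Z3 (nf x)"
        using Z1(2) Z3(2) by (auto simp: normal_def Z2_def split: option.splits)
      moreover have "Z3 9 = ([], [])" "Z3 10 = ([], [])"
        using Z1(3) Z3(2) by (simp_all add: Z2_def input_tapes_def)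
      ultimately have "halts [decide pmode] Z3 ?b (150 * nf_size (nf x) + 300)"
        using Z3(1) by (intro halts_decide)
      then show "halts [decide pmode] Z3 ?b ?T"
        by (rule halts_mono) (use nf_size_nf[of x] in simp)
    qed auto
    then show "halts [?k2] Z1 ?b (?T + 25 * length y + 50 + 4)"
      using Z1(1) by (auto simp: halts_step scan_def Z2_def elim!: halts_mono)
  qed (auto simp: input_tapes_def)
  then show ?thesis unfolding conjugacy_prog_def
    by (auto simp: halts_step elim!: halts_mono)
qed

definition tape_alphabet :: "nat \<Rightarrow> letter tape_symbol set" where
  "tape_alphabet n = {Blank, Separator} \<union> Input ` polycyclic_letters n"

text \<open>Every write is a copied symbol, a blank, a separator or an uninverted letter, so the
  input alphabet with the two markers is closed under the program.\<close>

lemma wf_conjugacy_prog: "wf_prog (tape_alphabet n) 11 (conjugacy_prog pmode)"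
proof -
  have keep: "wf_prog (tape_alphabet n) 11 (Op i (\<lambda>rd. rd j) m)" if "i < 11" for i j m
    using that by auto
  have const: "Blank \<in> tape_alphabet n" "Separator \<in> tape_alphabet n"
    by (auto simp: tape_alphabet_def)
  have "uninvert s \<in> tape_alphabet n" if "s \<in> tape_alphabet n" for s
    using that by (cases s rule: uninvert.cases) (auto simp: tape_alphabet_def polycyclic_letters_def)
  then have "wf_prog (tape_alphabet n) 11 (Op i (\<lambda>rd. uninvert (rd 0)) m)" if "i < 11" for i m
    using that by auto
  then show ?thesis
    using keep const
    by (simp add: conjugacy_prog_def analyse_def parse_def parse_letter_def mark_def normalise_def
      rewind_def rewind_loop_def strip_loop_def move_loop_def decide_def cyclic_test_def
      copy_loop_def compare_def compare_loop_def compare_body_def skip_back_def back_loop_def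
      equal_then_def equal_loop_def del: wf_prog.simps(1))
     (simp add: const)
qed

lemma conjugate_iff_test:
  assumes "n \<ge> 2" "x \<in> lists (polycyclic_letters n)" "y \<in> lists (polycyclic_letters n)"
  shows "p_conjugate (polycyclic_monoid n) (polycyclic_elem n x) (polycyclic_elem n y)
      \<longleftrightarrow> conj_test True (nf x) (nf y)"
    and "c_conjugate (polycyclic_monoid n) (polycyclic_elem n x) (polycyclic_elem n y)
      \<longleftrightarrow> conj_test False (nf x) (nf y)"
  using assms
  by (simp_all add: polycyclic_elem_eq_nf_elem p_conjugate_iff_test c_conjugate_iff_test valid_nf conj_test_def)

theorem theorem3p13:
  fixes n :: nat
    and rel :: "letter list set \<Rightarrow> letter list set \<Rightarrow> bool"
  assumes "n \<ge> 2"
    and "rel \<in> {p_conjugate (polycyclic_monoid n), c_conjugate (polycyclic_monoid n)}"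
  shows "\<exists>(M :: letter tm) (T :: nat \<Rightarrow> nat).
           wf_tm (polycyclic_letters n) M \<and>
           (\<lambda>m. real (T m)) \<in> O(\<lambda>m. real m) \<and>
           tm_decides_in_time (polycyclic_letters n) M
             (\<lambda>x y. rel (polycyclic_elem n x) (polycyclic_elem n y)) T"
proof -
  obtain pmode where pmode: "rel (polycyclic_elem n x) (polycyclic_elem n y) \<longleftrightarrow> conj_test pmode (nf x) (nf y)"
    if "x \<in> lists (polycyclic_letters n)" "y \<in> lists (polycyclic_letters n)" for x y
    using assms conjugate_iff_test by blast
  let ?M = "prog_tm (tape_alphabet n) 11 (conjugacy_prog pmode)"
  let ?T = "\<lambda>m. 200 * m + 500 :: nat"
  have "wf_tm (polycyclic_letters n) ?M"
    by (intro wf_prog_tm wf_conjugacy_prog) (auto simp: tape_alphabet_def polycyclic_letters_def)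
  moreover have "(\<lambda>m. real (?T m)) \<in> O(\<lambda>m. real m)"
    \<comment> \<open>For \<open>m \<ge> 1\<close> the constant 500 is at most
      \<open>500 * m\<close>, whence 700.\<close>
    by (intro bigoI[of _ 700] eventually_mono[OF eventually_ge_at_top[of 1]]) auto
  moreover have "tm_decides_in_time (polycyclic_letters n) ?M
      (\<lambda>x y. rel (polycyclic_elem n x) (polycyclic_elem n y)) ?T"
    using halts_conjugacy_prog by (intro prog_tm_decides wf_conjugacy_prog) (simp_all add: pmode)
  ultimately show ?thesis by (intro exI[of _ ?M] exI[of _ ?T] conjI)
qed

end
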